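(* If an algebra $H\in\Theta$ is LG-saturated, then it is MT-saturated.
   Context: Fix a variety $\Theta$, an infinite set of variables $X^0$, let $\Gamma$ be the set of finite subsets of $X^0$ and $\Gamma^*=\Gamma\cup\{X^0\}$; $W(X)$ is the free algebra of $\Theta$ over $X$. For $H\in\Theta$ and $X\in\Gamma^*$, $\mathrm{Hal}^X_\Theta(H)$ is the Boolean algebra of subsets of $\mathrm{Hom}(W(X),H)$ with quantifiers ($\mu\in\exists xA$ iff some $\nu\in A$ agrees with $\mu$ off $x$), equalities $[w\equiv w']_H=\{\mu:\mu(w)=\mu(w')\}$ and maps $s_*(A)=\{\mu:\mu\circ s\in A\}$ for homomorphisms $s:W(X)\to W(Y)$. The multi-sorted algebra of formulas $\Phi=(\Phi(X),X\in\Gamma^* )$ is the free Halmos algebra over the sets of formal equalities $w\equiv w'$, $w,w'\in W(X)$ (Halmos algebras: each sort an extended Boolean algebra with commuting quantifiers $\exists x$ and equalities, operations $s_*$ that are Boolean homomorphisms, functorial, and compatible with quantifiers and equalities); $\mathrm{Val}^X_H$ are the components of the unique homomorphism $\Phi\to\mathrm{Hal}_\Theta(H)$ sending $w\equiv w'$ to $[w\equiv w']_H$. A point $\mu$ satisfies $u$ iff $\mu\in\mathrm{Val}^X_H(u)$; $\mathrm{LKer}(\mu)$ is the set of formulas satisfied by $\mu$; $\mathrm{Th}^X(H)=\{u\in\Phi(X):\mathrm{Val}^X_H(u)=\mathrm{Hom}(W(X),H)\}$. $\Phi(X^0)$ is the Lindenbaum–Tarski algebra of first-order formulas with equalities in the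 signature of $\Theta$ over variables $X^0$. For $X=\{x_1,\dots,x_n\}\in\Gamma$, $u\in\Phi(X^0)$ is $X$-special if its free variables lie in $X$ and its bound variables lie in $X^0\setminus X$. An $X$-type over $H$ is a set $T$ of $X$-special formulas consistent with the elementary theory of $H$ (for every finite $\{u_1,\dots,u_k\}\subseteq T$ some point $W(X^0)\to H$ satisfies $u_1\wedge\dots\wedge u_k$). For $\mu:W(X)\to H$, $\mathrm{Tp}^H(\mu)$ is the set of $X$-special $u$ such that every $\eta:W(X^0)\to H$ with $\eta(x_i)=\mu(x_i)$ for all $i$ satisfies $u$. $H$ is LG-saturated if for every $X\in\Gamma$ every Boolean ultrafilter of $\Phi(X)$ containing $\mathrm{Th}^X(H)$ equals $\mathrm{LKer}(\mu)$ for some $\mu:W(X)\to H$. $H$ is MT-saturated if for every $X\in\Gamma$ and every $X$-type $T$ over $H$ there is $\mu:W(X)\to H$ with $T\subseteq\mathrm{Tp}^H(\mu)$. *)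

theory Defs
  imports "HOL-Library.FuncSet"
begin

section \<open>Varieties and free algebras\<close>

datatype ('f, 'v) trm = Var 'v | Op 'f "('f, 'v) trm list"

text \<open>
  A variety is given by a signature and a set of identities.  Every variety of finitary algebras
  is definable by identities in countably many variables, named here by natural numbers.
\<close>

record 'f variety =
  arity :: "'f \<Rightarrow> nat"
  idents :: "(('f, nat) trm \<times> ('f, nat) trm) set"

record ('f, 'a) algebra =
  carrier :: "'a set"
  ops :: "'f \<Rightarrow> 'a list \<Rightarrow> 'a"

inductive_set trms :: "'f variety \<Rightarrow> 'v set \<Rightarrow> ('f, 'v) trm set"
  for \<Theta> :: "'f variety" and X :: "'v set" where
  Var: "x \<in> X \<Longrightarrow> Var x \<in> trms \<Theta> X"
| Op: "length ts = arity \<Theta> f \<Longrightarrow> \<forall>t \<in> set ts. t \<in> trms \<Theta> X \<Longrightarrow> Op f ts \<in> trms \<Theta> X"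

definition is_variety :: "'f variety \<Rightarrow> bool" where
  "is_variety \<Theta> \<longleftrightarrow> idents \<Theta> \<subseteq> trms \<Theta> UNIV \<times> trms \<Theta> UNIV"

fun eval :: "('f, 'a) algebra \<Rightarrow> ('v \<Rightarrow> 'a) \<Rightarrow> ('f, 'v) trm \<Rightarrow> 'a" where
  "eval A \<rho> (Var x) = \<rho> x"
| "eval A \<rho> (Op f ts) = ops A f (map (eval A \<rho>) ts)"

fun subst :: "('v \<Rightarrow> ('f, 'w) trm) \<Rightarrow> ('f, 'v) trm \<Rightarrow> ('f, 'w) trm" where
  "subst \<sigma> (Var x) = \<sigma> x"
| "subst \<sigma> (Op f ts) = Op f (map (subst \<sigma>) ts)"

text \<open>Algebras with empty carrier are allowed (when the signature has no constants).\<close>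

definition in_variety :: "'f variety \<Rightarrow> ('f, 'a) algebra \<Rightarrow> bool" where
  "in_variety \<Theta> A \<longleftrightarrow>
     (\<forall>f as. length as = arity \<Theta> f \<and> set as \<subseteq> carrier A \<longrightarrow> ops A f as \<in> carrier A) \<and>
     (\<forall>(l, r) \<in> idents \<Theta>. \<forall>\<rho>. range \<rho> \<subseteq> carrier A \<longrightarrow> eval A \<rho> l = eval A \<rho> r)"

definition Hom :: "'f variety \<Rightarrow> ('f, 'a) algebra \<Rightarrow> ('f, 'b) algebra \<Rightarrow> ('a \<Rightarrow> 'b) set" where
  "Hom \<Theta> A B = {h \<in> carrier A \<rightarrow>\<^sub>E carrier B.
     \<forall>f as. length as = arity \<Theta> f \<and> set as \<subseteq> carrier A \<longrightarrow>
       h (ops A f as) = ops B f (map h as)}"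

text \<open>
  The smallest congruence on the term algebra over \<open>X\<close> that contains all instances of the
  identities; the free algebra \<open>W(X)\<close> is the quotient.  If \<open>X\<close> is empty and there are no constants,
  then \<open>W(X)\<close> is the empty algebra.
\<close>

inductive teq :: "'f variety \<Rightarrow> 'v set \<Rightarrow> ('f, 'v) trm \<Rightarrow> ('f, 'v) trm \<Rightarrow> bool"
  for \<Theta> :: "'f variety" and X :: "'v set" where
  refl: "t \<in> trms \<Theta> X \<Longrightarrow> teq \<Theta> X t t"
| sym: "teq \<Theta> X t t' \<Longrightarrow> teq \<Theta> X t' t"
| trans: "teq \<Theta> X t t' \<Longrightarrow> teq \<Theta> X t' t'' \<Longrightarrow> teq \<Theta> X t t''"
| cong: "length ts = arity \<Theta> f \<Longrightarrow> list_all2 (teq \<Theta> X) ts ts' \<Longrightarrow> teq \<Theta> X (Op f ts) (Op f ts')"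
| ident: "(l, r) \<in> idents \<Theta> \<Longrightarrow> range \<sigma> \<subseteq> trms \<Theta> X \<Longrightarrow> teq \<Theta> X (subst \<sigma> l) (subst \<sigma> r)"

definition cls :: "'f variety \<Rightarrow> 'v set \<Rightarrow> ('f, 'v) trm \<Rightarrow> ('f, 'v) trm set" where
  "cls \<Theta> X t = {t'. teq \<Theta> X t t'}"

definition W :: "'f variety \<Rightarrow> 'v set \<Rightarrow> ('f, ('f, 'v) trm set) algebra" where
  "W \<Theta> X = \<lparr> carrier = cls \<Theta> X ` trms \<Theta> X,
             ops = (\<lambda>f ws. cls \<Theta> X (Op f (map (\<lambda>w. SOME t. t \<in> w) ws))) \<rparr>"

abbreviation gen :: "'f variety \<Rightarrow> 'v set \<Rightarrow> 'v \<Rightarrow> ('f, 'v) trm set" where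
  "gen \<Theta> X x \<equiv> cls \<Theta> X (Var x)"

text \<open>The variables that cannot be avoided when writing \<open>w \<in> W(X)\<close> as a term.\<close>

definition supp :: "'f variety \<Rightarrow> 'v set \<Rightarrow> ('f, 'v) trm set \<Rightarrow> 'v set" where
  "supp \<Theta> X w = {y \<in> X. w \<notin> cls \<Theta> X ` trms \<Theta> (X - {y})}"

section \<open>Halmos algebras\<close>

text \<open>The index set \<open>\<Gamma>\<^sup>*\<close>.\<close>

definition sorts :: "'v set \<Rightarrow> 'v set set" where
  "sorts X0 = {X. X \<subseteq> X0 \<and> finite X} \<union> {X0}"

text \<open>
  The first argument of each operation is its sort; \<open>hsub A X Y s\<close> is the operation
  \<open>s\<^sub>*\<close> from sort \<open>X\<close> to sort \<open>Y\<close> attached to \<open>s : W(X) \<rightarrow> W(Y)\<close>.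
\<close>

record ('f, 'v, 'a) halmos_str =
  car :: "'v set \<Rightarrow> 'a set"
  hbot :: "'v set \<Rightarrow> 'a"
  htop :: "'v set \<Rightarrow> 'a"
  hneg :: "'v set \<Rightarrow> 'a \<Rightarrow> 'a"
  hand :: "'v set \<Rightarrow> 'a \<Rightarrow> 'a \<Rightarrow> 'a"
  hor :: "'v set \<Rightarrow> 'a \<Rightarrow> 'a \<Rightarrow> 'a"
  hex :: "'v set \<Rightarrow> 'v \<Rightarrow> 'a \<Rightarrow> 'a"
  heq :: "'v set \<Rightarrow> ('f, 'v) trm set \<Rightarrow> ('f, 'v) trm set \<Rightarrow> 'a"
  hsub :: "'v set \<Rightarrow> 'v set \<Rightarrow> (('f, 'v) trm set \<Rightarrow> ('f, 'v) trm set) \<Rightarrow> 'a \<Rightarrow> 'a"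

abbreviation hle :: "('f, 'v, 'a) halmos_str \<Rightarrow> 'v set \<Rightarrow> 'a \<Rightarrow> 'a \<Rightarrow> bool" where
  "hle A X a b \<equiv> hand A X a b = a"

abbreviation hands :: "('f, 'v, 'a) halmos_str \<Rightarrow> 'v set \<Rightarrow> 'a list \<Rightarrow> 'a" where
  "hands A X us \<equiv> foldr (hand A X) us (htop A X)"

definition boolean_sort :: "('f, 'v, 'a) halmos_str \<Rightarrow> 'v set \<Rightarrow> bool" where
  "boolean_sort A X \<longleftrightarrow>
     hbot A X \<in> car A X \<and> htop A X \<in> car A X \<and>
     (\<forall>a \<in> car A X.
        hneg A X a \<in> car A X \<and>
        hand A X a (htop A X) = a \<and> hor A X a (hbot A X) = a \<and>
        hand A X a (hneg A X a) = hbot A X \<and> hor A X a (hneg A X a) = htop A X) \<and>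
     (\<forall>a \<in> car A X. \<forall>b \<in> car A X.
        hand A X a b \<in> car A X \<and> hor A X a b \<in> car A X \<and>
        hand A X a b = hand A X b a \<and> hor A X a b = hor A X b a) \<and>
     (\<forall>a \<in> car A X. \<forall>b \<in> car A X. \<forall>c \<in> car A X.
        hand A X a (hor A X b c) = hor A X (hand A X a b) (hand A X a c) \<and>
        hor A X a (hand A X b c) = hand A X (hor A X a b) (hor A X a c))"

definition quantifier_sort :: "('f, 'v, 'a) halmos_str \<Rightarrow> 'v set \<Rightarrow> bool" where
  "quantifier_sort A X \<longleftrightarrow>
     (\<forall>x \<in> X. hex A X x (hbot A X) = hbot A X) \<and>
     (\<forall>x \<in> X. \<forall>a \<in> car A X. hex A X x a \<in> car A X \<and> hle A X a (hex A X x a)) \<and>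
     (\<forall>x \<in> X. \<forall>a \<in> car A X. \<forall>b \<in> car A X.
        hex A X x (hand A X a (hex A X x b)) = hand A X (hex A X x a) (hex A X x b)) \<and>
     (\<forall>x \<in> X. \<forall>y \<in> X. \<forall>a \<in> car A X. hex A X x (hex A X y a) = hex A X y (hex A X x a))"

text \<open>
  Symmetry and transitivity of the equalities are not listed: in a Halmos algebra they follow
  from reflexivity and the replacement axiom for \<open>s\<^sub>*\<close> below.
\<close>

definition equality_sort :: "'f variety \<Rightarrow> ('f, 'v, 'a) halmos_str \<Rightarrow> 'v set \<Rightarrow> bool" where
  "equality_sort \<Theta> A X \<longleftrightarrow>
     (\<forall>w \<in> carrier (W \<Theta> X). \<forall>w' \<in> carrier (W \<Theta> X). heq A X w w' \<in> car A X) \<and>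
     (\<forall>w \<in> carrier (W \<Theta> X). heq A X w w = htop A X) \<and>
     (\<forall>f ws ws'. length ws = arity \<Theta> f \<and> length ws' = arity \<Theta> f \<and>
        set ws \<subseteq> carrier (W \<Theta> X) \<and> set ws' \<subseteq> carrier (W \<Theta> X) \<longrightarrow>
        hle A X (hands A X (map2 (heq A X) ws ws'))
                (heq A X (ops (W \<Theta> X) f ws) (ops (W \<Theta> X) f ws')))"

definition extended_boolean :: "'f variety \<Rightarrow> ('f, 'v, 'a) halmos_str \<Rightarrow> 'v set \<Rightarrow> bool" where
  "extended_boolean \<Theta> A X \<longleftrightarrow> boolean_sort A X \<and> quantifier_sort A X \<and> equality_sort \<Theta> A X"

definition sub_boolean_hom ::
  "'f variety \<Rightarrow> 'v set \<Rightarrow> ('f, 'v, 'a) halmos_str \<Rightarrow> bool" where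
  "sub_boolean_hom \<Theta> X0 A \<longleftrightarrow>
     (\<forall>X \<in> sorts X0. \<forall>Y \<in> sorts X0. \<forall>s \<in> Hom \<Theta> (W \<Theta> X) (W \<Theta> Y).
        hsub A X Y s (hbot A X) = hbot A Y \<and> hsub A X Y s (htop A X) = htop A Y \<and>
        (\<forall>a \<in> car A X. hsub A X Y s a \<in> car A Y \<and>
           hsub A X Y s (hneg A X a) = hneg A Y (hsub A X Y s a)) \<and>
        (\<forall>a \<in> car A X. \<forall>b \<in> car A X.
           hsub A X Y s (hand A X a b) = hand A Y (hsub A X Y s a) (hsub A X Y s b) \<and>
           hsub A X Y s (hor A X a b) = hor A Y (hsub A X Y s a) (hsub A X Y s b)))"

definition sub_functorial ::
  "'f variety \<Rightarrow> 'v set \<Rightarrow> ('f, 'v, 'a) halmos_str \<Rightarrow> bool" where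
  "sub_functorial \<Theta> X0 A \<longleftrightarrow>
     (\<forall>X \<in> sorts X0. \<forall>a \<in> car A X. hsub A X X (restrict id (carrier (W \<Theta> X))) a = a) \<and>
     (\<forall>X \<in> sorts X0. \<forall>Y \<in> sorts X0. \<forall>Z \<in> sorts X0.
        \<forall>s \<in> Hom \<Theta> (W \<Theta> X) (W \<Theta> Y). \<forall>s' \<in> Hom \<Theta> (W \<Theta> Y) (W \<Theta> Z). \<forall>a \<in> car A X.
        hsub A X Z (compose (carrier (W \<Theta> X)) s' s) a = hsub A Y Z s' (hsub A X Y s a))"

definition sub_quantifiers ::
  "'f variety \<Rightarrow> 'v set \<Rightarrow> ('f, 'v, 'a) halmos_str \<Rightarrow> bool" where
  "sub_quantifiers \<Theta> X0 A \<longleftrightarrow>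
     (\<forall>X \<in> sorts X0. \<forall>Y \<in> sorts X0. \<forall>x \<in> X. \<forall>a \<in> car A X.
        \<forall>s1 \<in> Hom \<Theta> (W \<Theta> X) (W \<Theta> Y). \<forall>s2 \<in> Hom \<Theta> (W \<Theta> X) (W \<Theta> Y).
        (\<forall>x' \<in> X. x' \<noteq> x \<longrightarrow> s1 (gen \<Theta> X x') = s2 (gen \<Theta> X x')) \<longrightarrow>
        hsub A X Y s1 (hex A X x a) = hsub A X Y s2 (hex A X x a)) \<and>
     (\<forall>X \<in> sorts X0. \<forall>Y \<in> sorts X0. \<forall>x \<in> X. \<forall>y \<in> Y. \<forall>a \<in> car A X.
        \<forall>s \<in> Hom \<Theta> (W \<Theta> X) (W \<Theta> Y).
        s (gen \<Theta> X x) = gen \<Theta> Y y \<and>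
        (\<forall>x' \<in> X. x' \<noteq> x \<longrightarrow> y \<notin> supp \<Theta> Y (s (gen \<Theta> X x'))) \<longrightarrow>
        hsub A X Y s (hex A X x a) = hex A Y y (hsub A X Y s a))"

text \<open>In the second clause \<open>s\<close> and \<open>s'\<close> are the substitutions of \<open>w\<close> and \<open>w'\<close> for \<open>x\<close>.\<close>

definition sub_equalities ::
  "'f variety \<Rightarrow> 'v set \<Rightarrow> ('f, 'v, 'a) halmos_str \<Rightarrow> bool" where
  "sub_equalities \<Theta> X0 A \<longleftrightarrow>
     (\<forall>X \<in> sorts X0. \<forall>Y \<in> sorts X0. \<forall>s \<in> Hom \<Theta> (W \<Theta> X) (W \<Theta> Y).
        \<forall>w \<in> carrier (W \<Theta> X). \<forall>w' \<in> carrier (W \<Theta> X).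
        hsub A X Y s (heq A X w w') = heq A Y (s w) (s w')) \<and>
     (\<forall>X \<in> sorts X0. \<forall>x \<in> X. \<forall>a \<in> car A X.
        \<forall>w \<in> carrier (W \<Theta> X). \<forall>w' \<in> carrier (W \<Theta> X).
        \<forall>s \<in> Hom \<Theta> (W \<Theta> X) (W \<Theta> X). \<forall>s' \<in> Hom \<Theta> (W \<Theta> X) (W \<Theta> X).
        s (gen \<Theta> X x) = w \<and> s' (gen \<Theta> X x) = w' \<and>
        (\<forall>x' \<in> X. x' \<noteq> x \<longrightarrow> s (gen \<Theta> X x') = gen \<Theta> X x' \<and> s' (gen \<Theta> X x') = gen \<Theta> X x') \<longrightarrow>
        hle A X (hand A X (hsub A X X s a) (heq A X w w')) (hsub A X X s' a))"

definition halmos_algebra ::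
  "'f variety \<Rightarrow> 'v set \<Rightarrow> ('f, 'v, 'a) halmos_str \<Rightarrow> bool" where
  "halmos_algebra \<Theta> X0 A \<longleftrightarrow>
     (\<forall>X \<in> sorts X0. extended_boolean \<Theta> A X) \<and>
     sub_boolean_hom \<Theta> X0 A \<and> sub_functorial \<Theta> X0 A \<and>
     sub_quantifiers \<Theta> X0 A \<and> sub_equalities \<Theta> X0 A"

text \<open>
  Homomorphisms preserve the equalities, which are constants of the signature.  They are
  families of maps, extensional both in the sort and in the element, so that they are
  determined by their values on the carriers.
\<close>

definition halmos_hom ::
  "'f variety \<Rightarrow> 'v set \<Rightarrow> ('f, 'v, 'a) halmos_str \<Rightarrow> ('f, 'v, 'b) halmos_str
    \<Rightarrow> ('v set \<Rightarrow> 'a \<Rightarrow> 'b) \<Rightarrow> bool" where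
  "halmos_hom \<Theta> X0 A B h \<longleftrightarrow>
     h \<in> (\<Pi>\<^sub>E X \<in> sorts X0. car A X \<rightarrow>\<^sub>E car B X) \<and>
     (\<forall>X \<in> sorts X0.
        h X (hbot A X) = hbot B X \<and> h X (htop A X) = htop B X \<and>
        (\<forall>a \<in> car A X. h X (hneg A X a) = hneg B X (h X a)) \<and>
        (\<forall>a \<in> car A X. \<forall>b \<in> car A X.
           h X (hand A X a b) = hand B X (h X a) (h X b) \<and>
           h X (hor A X a b) = hor B X (h X a) (h X b)) \<and>
        (\<forall>x \<in> X. \<forall>a \<in> car A X. h X (hex A X x a) = hex B X x (h X a)) \<and>
        (\<forall>w \<in> carrier (W \<Theta> X). \<forall>w' \<in> carrier (W \<Theta> X). h X (heq A X w w') = heq B X w w')) \<and>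
     (\<forall>X \<in> sorts X0. \<forall>Y \<in> sorts X0. \<forall>s \<in> Hom \<Theta> (W \<Theta> X) (W \<Theta> Y). \<forall>a \<in> car A X.
        h Y (hsub A X Y s a) = hsub B X Y s (h X a))"

definition Hal ::
  "'f variety \<Rightarrow> ('f, 'h) algebra \<Rightarrow> ('f, 'v, (('f, 'v) trm set \<Rightarrow> 'h) set) halmos_str" where
  "Hal \<Theta> H = \<lparr>
     car = (\<lambda>X. Pow (Hom \<Theta> (W \<Theta> X) H)),
     hbot = (\<lambda>X. {}),
     htop = (\<lambda>X. Hom \<Theta> (W \<Theta> X) H),
     hneg = (\<lambda>X A. Hom \<Theta> (W \<Theta> X) H - A),
     hand = (\<lambda>X A B. A \<inter> B),
     hor = (\<lambda>X A B. A \<union> B),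
     hex = (\<lambda>X x A. {\<mu> \<in> Hom \<Theta> (W \<Theta> X) H.
              \<exists>\<nu> \<in> A. \<forall>y \<in> X. y \<noteq> x \<longrightarrow> \<mu> (gen \<Theta> X y) = \<nu> (gen \<Theta> X y)}),
     heq = (\<lambda>X w w'. {\<mu> \<in> Hom \<Theta> (W \<Theta> X) H. \<mu> w = \<mu> w'}),
     hsub = (\<lambda>X Y s A. {\<mu> \<in> Hom \<Theta> (W \<Theta> Y) H. compose (carrier (W \<Theta> X)) \<mu> s \<in> A}) \<rparr>"

section \<open>The algebra of formulas\<close>

datatype ('f, 'v) hterm =
    HEq "('f, 'v) trm set" "('f, 'v) trm set"
  | HBot
  | HTop
  | HNeg "('f, 'v) hterm"
  | HAnd "('f, 'v) hterm" "('f, 'v) hterm"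
  | HOr "('f, 'v) hterm" "('f, 'v) hterm"
  | HEx 'v "('f, 'v) hterm"
  | HSub "'v set" "('f, 'v) trm set \<Rightarrow> ('f, 'v) trm set" "('f, 'v) hterm"

inductive_set hterms :: "'f variety \<Rightarrow> 'v set \<Rightarrow> ('v set \<times> ('f, 'v) hterm) set"
  for \<Theta> :: "'f variety" and X0 :: "'v set" where
  HEq: "X \<in> sorts X0 \<Longrightarrow> w \<in> carrier (W \<Theta> X) \<Longrightarrow> w' \<in> carrier (W \<Theta> X) \<Longrightarrow>
    (X, HEq w w') \<in> hterms \<Theta> X0"
| HBot: "X \<in> sorts X0 \<Longrightarrow> (X, HBot) \<in> hterms \<Theta> X0"
| HTop: "X \<in> sorts X0 \<Longrightarrow> (X, HTop) \<in> hterms \<Theta> X0"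
| HNeg: "(X, u) \<in> hterms \<Theta> X0 \<Longrightarrow> (X, HNeg u) \<in> hterms \<Theta> X0"
| HAnd: "(X, u) \<in> hterms \<Theta> X0 \<Longrightarrow> (X, v) \<in> hterms \<Theta> X0 \<Longrightarrow> (X, HAnd u v) \<in> hterms \<Theta> X0"
| HOr: "(X, u) \<in> hterms \<Theta> X0 \<Longrightarrow> (X, v) \<in> hterms \<Theta> X0 \<Longrightarrow> (X, HOr u v) \<in> hterms \<Theta> X0"
| HEx: "x \<in> X \<Longrightarrow> (X, u) \<in> hterms \<Theta> X0 \<Longrightarrow> (X, HEx x u) \<in> hterms \<Theta> X0"
| HSub: "Y \<in> sorts X0 \<Longrightarrow> s \<in> Hom \<Theta> (W \<Theta> X) (W \<Theta> Y) \<Longrightarrow> (X, u) \<in> hterms \<Theta> X0 \<Longrightarrow>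
    (Y, HSub X s u) \<in> hterms \<Theta> X0"

text \<open>The absolutely free algebra over the formal equalities.\<close>

definition term_str :: "'f variety \<Rightarrow> 'v set \<Rightarrow> ('f, 'v, ('f, 'v) hterm) halmos_str" where
  "term_str \<Theta> X0 = \<lparr>
     car = (\<lambda>X. {u. (X, u) \<in> hterms \<Theta> X0}),
     hbot = (\<lambda>X. HBot), htop = (\<lambda>X. HTop), hneg = (\<lambda>X. HNeg),
     hand = (\<lambda>X. HAnd), hor = (\<lambda>X. HOr), hex = (\<lambda>X. HEx), heq = (\<lambda>X. HEq),
     hsub = (\<lambda>X Y. HSub X) \<rparr>"

definition halmos_congruence ::
  "'f variety \<Rightarrow> 'v set \<Rightarrow> ('f, 'v, 'a) halmos_str \<Rightarrow> ('v set \<Rightarrow> ('a \<times> 'a) set) \<Rightarrow> bool" where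
  "halmos_congruence \<Theta> X0 A \<theta> \<longleftrightarrow>
     (\<forall>X \<in> sorts X0. equiv (car A X) (\<theta> X) \<and>
        (\<forall>(a, b) \<in> \<theta> X. (hneg A X a, hneg A X b) \<in> \<theta> X) \<and>
        (\<forall>(a, b) \<in> \<theta> X. \<forall>(c, d) \<in> \<theta> X.
           (hand A X a c, hand A X b d) \<in> \<theta> X \<and> (hor A X a c, hor A X b d) \<in> \<theta> X) \<and>
        (\<forall>x \<in> X. \<forall>(a, b) \<in> \<theta> X. (hex A X x a, hex A X x b) \<in> \<theta> X)) \<and>
     (\<forall>X \<in> sorts X0. \<forall>Y \<in> sorts X0. \<forall>s \<in> Hom \<Theta> (W \<Theta> X) (W \<Theta> Y).
        \<forall>(a, b) \<in> \<theta> X. (hsub A X Y s a, hsub A X Y s b) \<in> \<theta> Y)"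

definition quotient_str ::
  "('f, 'v, 'a) halmos_str \<Rightarrow> ('v set \<Rightarrow> ('a \<times> 'a) set) \<Rightarrow> ('f, 'v, 'a set) halmos_str" where
  "quotient_str A \<theta> = \<lparr>
     car = (\<lambda>X. car A X // \<theta> X),
     hbot = (\<lambda>X. \<theta> X `` {hbot A X}),
     htop = (\<lambda>X. \<theta> X `` {htop A X}),
     hneg = (\<lambda>X a. \<Union>u\<in>a. \<theta> X `` {hneg A X u}),
     hand = (\<lambda>X a b. \<Union>u\<in>a. \<Union>v\<in>b. \<theta> X `` {hand A X u v}),
     hor = (\<lambda>X a b. \<Union>u\<in>a. \<Union>v\<in>b. \<theta> X `` {hor A X u v}),
     hex = (\<lambda>X x a. \<Union>u\<in>a. \<theta> X `` {hex A X x u}),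
     heq = (\<lambda>X w w'. \<theta> X `` {heq A X w w'}),
     hsub = (\<lambda>X Y s a. \<Union>u\<in>a. \<theta> Y `` {hsub A X Y s u}) \<rparr>"

text \<open>
  The verbal congruence of the identities of Halmos algebras: the smallest congruence on the
  absolutely free algebra whose quotient is a Halmos algebra.
\<close>

definition verbal_congruence ::
  "'f variety \<Rightarrow> 'v set \<Rightarrow> 'v set \<Rightarrow> (('f, 'v) hterm \<times> ('f, 'v) hterm) set" where
  "verbal_congruence \<Theta> X0 X =
     \<Inter> {\<theta> X | \<theta>. halmos_congruence \<Theta> X0 (term_str \<Theta> X0) \<theta> \<and>
                halmos_algebra \<Theta> X0 (quotient_str (term_str \<Theta> X0) \<theta>)}"

definition \<Phi> :: "'f variety \<Rightarrow> 'v set \<Rightarrow> ('f, 'v, ('f, 'v) hterm set) halmos_str" where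
  "\<Phi> \<Theta> X0 = quotient_str (term_str \<Theta> X0) (verbal_congruence \<Theta> X0)"

definition Val ::
  "'f variety \<Rightarrow> 'v set \<Rightarrow> ('f, 'h) algebra \<Rightarrow> 'v set \<Rightarrow> ('f, 'v) hterm set
    \<Rightarrow> (('f, 'v) trm set \<Rightarrow> 'h) set" where
  "Val \<Theta> X0 H = (THE h. halmos_hom \<Theta> X0 (\<Phi> \<Theta> X0) (Hal \<Theta> H) h)"

definition LKer ::
  "'f variety \<Rightarrow> 'v set \<Rightarrow> ('f, 'h) algebra \<Rightarrow> 'v set \<Rightarrow> (('f, 'v) trm set \<Rightarrow> 'h)
    \<Rightarrow> ('f, 'v) hterm set set" where
  "LKer \<Theta> X0 H X \<mu> = {u \<in> car (\<Phi> \<Theta> X0) X. \<mu> \<in> Val \<Theta> X0 H X u}"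

definition Th ::
  "'f variety \<Rightarrow> 'v set \<Rightarrow> ('f, 'h) algebra \<Rightarrow> 'v set \<Rightarrow> ('f, 'v) hterm set set" where
  "Th \<Theta> X0 H X = {u \<in> car (\<Phi> \<Theta> X0) X. Val \<Theta> X0 H X u = Hom \<Theta> (W \<Theta> X) H}"

section \<open>LG-saturation\<close>

definition proper_filter :: "('f, 'v, 'a) halmos_str \<Rightarrow> 'v set \<Rightarrow> 'a set \<Rightarrow> bool" where
  "proper_filter A X F \<longleftrightarrow>
     F \<subseteq> car A X \<and> htop A X \<in> F \<and> hbot A X \<notin> F \<and>
     (\<forall>a \<in> F. \<forall>b \<in> F. hand A X a b \<in> F) \<and>
     (\<forall>a \<in> F. \<forall>b \<in> car A X. hle A X a b \<longrightarrow> b \<in> F)"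

definition ultrafilter :: "('f, 'v, 'a) halmos_str \<Rightarrow> 'v set \<Rightarrow> 'a set \<Rightarrow> bool" where
  "ultrafilter A X F \<longleftrightarrow>
     proper_filter A X F \<and> (\<forall>G. proper_filter A X G \<and> F \<subseteq> G \<longrightarrow> G = F)"

definition LG_saturated :: "'f variety \<Rightarrow> 'v set \<Rightarrow> ('f, 'h) algebra \<Rightarrow> bool" where
  "LG_saturated \<Theta> X0 H \<longleftrightarrow>
     (\<forall>X U. X \<subseteq> X0 \<and> finite X \<and> ultrafilter (\<Phi> \<Theta> X0) X U \<and> Th \<Theta> X0 H X \<subseteq> U \<longrightarrow>
        (\<exists>\<mu> \<in> Hom \<Theta> (W \<Theta> X) H. U = LKer \<Theta> X0 H X \<mu>))"

section \<open>MT-saturation\<close>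

datatype ('f, 'v) fo =
    FEq "('f, 'v) trm" "('f, 'v) trm"
  | FNeg "('f, 'v) fo"
  | FAnd "('f, 'v) fo" "('f, 'v) fo"
  | FOr "('f, 'v) fo" "('f, 'v) fo"
  | FEx 'v "('f, 'v) fo"

fun tvars :: "('f, 'v) trm \<Rightarrow> 'v set" where
  "tvars (Var x) = {x}"
| "tvars (Op f ts) = (\<Union>t \<in> set ts. tvars t)"

fun free_vars :: "('f, 'v) fo \<Rightarrow> 'v set" where
  "free_vars (FEq t t') = tvars t \<union> tvars t'"
| "free_vars (FNeg p) = free_vars p"
| "free_vars (FAnd p q) = free_vars p \<union> free_vars q"
| "free_vars (FOr p q) = free_vars p \<union> free_vars q"
| "free_vars (FEx x p) = free_vars p - {x}"

fun bound_vars :: "('f, 'v) fo \<Rightarrow> 'v set" where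
  "bound_vars (FEq t t') = {}"
| "bound_vars (FNeg p) = bound_vars p"
| "bound_vars (FAnd p q) = bound_vars p \<union> bound_vars q"
| "bound_vars (FOr p q) = bound_vars p \<union> bound_vars q"
| "bound_vars (FEx x p) = insert x (bound_vars p)"

fun fo_over :: "'f variety \<Rightarrow> 'v set \<Rightarrow> ('f, 'v) fo \<Rightarrow> bool" where
  "fo_over \<Theta> X0 (FEq t t') \<longleftrightarrow> t \<in> trms \<Theta> X0 \<and> t' \<in> trms \<Theta> X0"
| "fo_over \<Theta> X0 (FNeg p) \<longleftrightarrow> fo_over \<Theta> X0 p"
| "fo_over \<Theta> X0 (FAnd p q) \<longleftrightarrow> fo_over \<Theta> X0 p \<and> fo_over \<Theta> X0 q"
| "fo_over \<Theta> X0 (FOr p q) \<longleftrightarrow> fo_over \<Theta> X0 p \<and> fo_over \<Theta> X0 q"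
| "fo_over \<Theta> X0 (FEx x p) \<longleftrightarrow> x \<in> X0 \<and> fo_over \<Theta> X0 p"

text \<open>The element of \<open>\<Phi>(X\<^sup>0)\<close> represented by a first-order formula.\<close>

fun fo_class :: "'f variety \<Rightarrow> 'v set \<Rightarrow> ('f, 'v) fo \<Rightarrow> ('f, 'v) hterm set" where
  "fo_class \<Theta> X0 (FEq t t') = heq (\<Phi> \<Theta> X0) X0 (cls \<Theta> X0 t) (cls \<Theta> X0 t')"
| "fo_class \<Theta> X0 (FNeg p) = hneg (\<Phi> \<Theta> X0) X0 (fo_class \<Theta> X0 p)"
| "fo_class \<Theta> X0 (FAnd p q) = hand (\<Phi> \<Theta> X0) X0 (fo_class \<Theta> X0 p) (fo_class \<Theta> X0 q)"
| "fo_class \<Theta> X0 (FOr p q) = hor (\<Phi> \<Theta> X0) X0 (fo_class \<Theta> X0 p) (fo_class \<Theta> X0 q)"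
| "fo_class \<Theta> X0 (FEx x p) = hex (\<Phi> \<Theta> X0) X0 x (fo_class \<Theta> X0 p)"

text \<open>
  Free and bound variables belong to formulas, not to their classes: an element of
  \<open>\<Phi>(X\<^sup>0)\<close> is \<open>X\<close>-special if some formula representing it is.
\<close>

definition special :: "'f variety \<Rightarrow> 'v set \<Rightarrow> 'v set \<Rightarrow> ('f, 'v) hterm set set" where
  "special \<Theta> X0 X = {fo_class \<Theta> X0 p | p.
     fo_over \<Theta> X0 p \<and> free_vars p \<subseteq> X \<and> bound_vars p \<subseteq> X0 - X}"

definition X_type ::
  "'f variety \<Rightarrow> 'v set \<Rightarrow> ('f, 'h) algebra \<Rightarrow> 'v set \<Rightarrow> ('f, 'v) hterm set set \<Rightarrow> bool" where
  "X_type \<Theta> X0 H X T \<longleftrightarrow>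
     T \<subseteq> special \<Theta> X0 X \<and>
     (\<forall>us. set us \<subseteq> T \<longrightarrow>
        (\<exists>\<mu> \<in> Hom \<Theta> (W \<Theta> X0) H. \<mu> \<in> Val \<Theta> X0 H X0 (hands (\<Phi> \<Theta> X0) X0 us)))"

definition Tp ::
  "'f variety \<Rightarrow> 'v set \<Rightarrow> ('f, 'h) algebra \<Rightarrow> 'v set \<Rightarrow> (('f, 'v) trm set \<Rightarrow> 'h)
    \<Rightarrow> ('f, 'v) hterm set set" where
  "Tp \<Theta> X0 H X \<mu> = {u \<in> special \<Theta> X0 X.
     \<forall>\<eta> \<in> Hom \<Theta> (W \<Theta> X0) H.
       (\<forall>x \<in> X. \<eta> (gen \<Theta> X0 x) = \<mu> (gen \<Theta> X x)) \<longrightarrow> \<eta> \<in> Val \<Theta> X0 H X0 u}"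

definition MT_saturated :: "'f variety \<Rightarrow> 'v set \<Rightarrow> ('f, 'h) algebra \<Rightarrow> bool" where
  "MT_saturated \<Theta> X0 H \<longleftrightarrow>
     (\<forall>X T. X \<subseteq> X0 \<and> finite X \<and> X_type \<Theta> X0 H X T \<longrightarrow>
        (\<exists>\<mu> \<in> Hom \<Theta> (W \<Theta> X) H. T \<subseteq> Tp \<Theta> X0 H X \<mu>))"

end

theory Submission
  imports Defs
begin

text \<open>
  For nonempty \<open>X\<close> choose a homomorphism \<open>s : W(X0) \<rightarrow> W(X)\<close> that fixes the variables in \<open>X\<close>.  The truth of
  an \<open>X\<close>-special formula \<open>u\<close> at a point depends only on the values of the point on \<open>X\<close>, so \<open>\<mu>\<close> satisfies
  \<open>s\<^sub>* u\<close> iff every extension of \<open>\<mu>\<close> to \<open>X0\<close> satisfies \<open>u\<close>.  If \<open>T\<close> is an \<open>X\<close>-type, then the elements of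
  \<open>\<Phi>(X)\<close> that hold wherever finitely many \<open>s\<^sub>* u\<close>, \<open>u \<in> T\<close>, hold form a proper filter containing the theory of \<open>H\<close>.
  An ultrafilter above it is the kernel of a point by LG-saturation, and this point realizes \<open>T\<close>.

  The values of formulas are only available through the universal property of \<open>\<Phi>\<close>.  Existence of
  \<open>\<Phi> \<rightarrow> Hal(H)\<close> holds because the kernel of the evaluation of terms in \<open>Hal(H)\<close> is one of the
  congruences intersected in the verbal congruence: its quotient embeds into \<open>Hal(H)\<close> and thus
  inherits the axioms of Halmos algebras.
\<close>

section \<open>Free algebras\<close>

lemma trms_mono:
  assumes "X \<subseteq> Y" shows "trms \<Theta> X \<subseteq> trms \<Theta> Y"
proof
  fix t assume "t \<in> trms \<Theta> X"
  then show "t \<in> trms \<Theta> Y"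
    by induction (use assms in \<open>auto intro: trms.intros\<close>)
qed

lemma tvars_trms: "t \<in> trms \<Theta> X \<Longrightarrow> tvars t \<subseteq> X"
  by (induction rule: trms.induct) auto

lemma subst_trms:
  assumes "t \<in> trms \<Theta> Z" "\<And>z. z \<in> Z \<Longrightarrow> \<sigma> z \<in> trms \<Theta> X"
  shows "subst \<sigma> t \<in> trms \<Theta> X"
  using assms(1) by induction (use assms(2) in \<open>auto intro!: trms.Op\<close>)

lemma eval_cong_tvars: "(\<And>x. x \<in> tvars t \<Longrightarrow> \<rho> x = \<rho>' x) \<Longrightarrow> eval A \<rho> t = eval A \<rho>' t"
proof (induction t)
  case (Op f ts)
  have "map (eval A \<rho>) ts = map (eval A \<rho>') ts"
    by (rule map_cong) (use Op in auto)
  then show ?case by (simp only: eval.simps)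
qed simp

lemma eval_subst: "eval A \<rho> (subst \<sigma> t) = eval A (\<lambda>x. eval A \<rho> (\<sigma> x)) t"
  by (induction t) (auto intro!: arg_cong[where f = "ops A _"])

lemma eval_carrier:
  assumes A: "in_variety \<Theta> A" and \<rho>: "\<And>x. x \<in> X \<Longrightarrow> \<rho> x \<in> carrier A" and "t \<in> trms \<Theta> X"
  shows "eval A \<rho> t \<in> carrier A"
  using assms(3)
proof induction
  case (Op ts f)
  then have "length (map (eval A \<rho>) ts) = arity \<Theta> f" "set (map (eval A \<rho>) ts) \<subseteq> carrier A"
    by auto
  then show ?case using A unfolding in_variety_def by simp
qed (use \<rho> in auto)

text \<open>Soundness of equational logic, which makes evaluation well defined on the classes
  forming W(X). For an instance of an identity, \<open>eval_subst\<close> replaces the substitution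
  by the assignment \<open>\<lambda>x. eval A \<rho> (\<sigma> x)\<close>, which stays in
  \<open>carrier A\<close> at every variable because \<sigma> takes only terms over X as
  values.\<close>

lemma eval_teq:
  assumes A: "in_variety \<Theta> A" and \<rho>: "\<And>x. x \<in> X \<Longrightarrow> \<rho> x \<in> carrier A" and "teq \<Theta> X t t'"
  shows "eval A \<rho> t = eval A \<rho> t'"
  using assms(3)
proof induction
  case (cong ts f ts')
  then have "map (eval A \<rho>) ts = map (eval A \<rho>) ts'"
    by (auto simp: list_all2_conv_all_nth intro: nth_equalityI)
  then show ?case by simp
next
  case (ident l r \<sigma>)
  have "range (\<lambda>x. eval A \<rho> (\<sigma> x)) \<subseteq> carrier A"
    using ident(2) by (auto intro!: eval_carrier[OF A \<rho>])
  then show ?case using ident(1) A unfolding in_variety_def eval_subst by auto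
qed auto

section \<open>The free algebra as a quotient of the term algebra\<close>

lemma cls_self: "t \<in> trms \<Theta> X \<Longrightarrow> t \<in> cls \<Theta> X t"
  by (simp add: cls_def teq.refl)

lemma cls_eqI: "teq \<Theta> X t t' \<Longrightarrow> cls \<Theta> X t = cls \<Theta> X t'"
  unfolding cls_def by (auto intro: teq.trans teq.sym)

lemma teq_some_cls: "t \<in> trms \<Theta> X \<Longrightarrow> teq \<Theta> X t (SOME t'. t' \<in> cls \<Theta> X t)"
  using someI[of "\<lambda>t'. t' \<in> cls \<Theta> X t", OF cls_self] by (simp add: cls_def)

lemma carrier_W: "carrier (W \<Theta> X) = cls \<Theta> X ` trms \<Theta> X"
  by (simp add: W_def)

lemma cls_carrier: "t \<in> trms \<Theta> X \<Longrightarrow> cls \<Theta> X t \<in> carrier (W \<Theta> X)"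
  by (simp add: carrier_W)

lemma gen_carrier: "x \<in> X \<Longrightarrow> gen \<Theta> X x \<in> carrier (W \<Theta> X)"
  by (simp add: carrier_W trms.Var)

text \<open>\<open>W\<close> applies an operation to representatives picked by \<open>SOME\<close>.
  Each picked term is provably equal to the given one, so the congruence rule makes the choice
  immaterial.\<close>

lemma ops_W:
  assumes "length ts = arity \<Theta> f" "set ts \<subseteq> trms \<Theta> X"
  shows "ops (W \<Theta> X) f (map (cls \<Theta> X) ts) = cls \<Theta> X (Op f ts)"
proof -
  have "list_all2 (teq \<Theta> X) ts (map (\<lambda>w. SOME t. t \<in> w) (map (cls \<Theta> X) ts))"
    using assms(2) by (auto simp: list_all2_conv_all_nth intro!: teq_some_cls)
  then show ?thesis
    unfolding W_def using teq.cong[OF assms(1)] by (auto intro!: cls_eqI intro: teq.sym simp del: list.map_comp)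
qed

lemma W_list_reps:
  assumes "set ws \<subseteq> carrier (W \<Theta> X)"
  obtains ts where "set ts \<subseteq> trms \<Theta> X" "ws = map (cls \<Theta> X) ts"
proof -
  have "ws \<in> lists (cls \<Theta> X ` trms \<Theta> X)" using assms by (auto simp: carrier_W)
  then show ?thesis using that unfolding lists_image by auto
qed

lemma W_ops_carrier:
  assumes "length ws = arity \<Theta> f" "set ws \<subseteq> carrier (W \<Theta> X)"
  shows "ops (W \<Theta> X) f ws \<in> carrier (W \<Theta> X)"
  using assms(1) by (rule_tac W_list_reps[OF assms(2)]) (auto simp: ops_W intro!: cls_carrier trms.Op)

lemma eval_W:
  assumes "t \<in> trms \<Theta> Z" "\<And>z. z \<in> Z \<Longrightarrow> \<sigma> z \<in> trms \<Theta> X"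
  shows "eval (W \<Theta> X) (\<lambda>z. cls \<Theta> X (\<sigma> z)) t = cls \<Theta> X (subst \<sigma> t)"
  using assms(1)
proof induction
  case (Op ts f)
  have eq: "map (eval (W \<Theta> X) (\<lambda>z. cls \<Theta> X (\<sigma> z))) ts = map (cls \<Theta> X) (map (subst \<sigma>) ts)"
    using Op by auto
  have "set (map (subst \<sigma>) ts) \<subseteq> trms \<Theta> X"
    using Op by (auto intro: subst_trms assms(2))
  then show ?case
    unfolding eval.simps subst.simps eq using Op by (intro ops_W) auto
qed simp

text \<open>An assignment into W(X) lifts to a substitution by representing terms, and evaluating at
  it means substituting and taking the class (\<open>eval_W\<close>). An identity thereby turns into
  one of its instances, which \<open>teq\<close> contains. \<open>is_variety\<close> supplies the
  well-formedness of both sides that \<open>eval_W\<close> asks for.\<close>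

lemma in_variety_W:
  assumes \<Theta>: "is_variety \<Theta>"
  shows "in_variety \<Theta> (W \<Theta> X)"
proof -
  have "eval (W \<Theta> X) \<rho> l = eval (W \<Theta> X) \<rho> r"
    if lr: "(l, r) \<in> idents \<Theta>" and \<rho>: "range \<rho> \<subseteq> carrier (W \<Theta> X)" for l r \<rho>
  proof -
    have "\<forall>i. \<exists>t. t \<in> trms \<Theta> X \<and> \<rho> i = cls \<Theta> X t" using \<rho> unfolding carrier_W by blast
    then obtain \<sigma> where \<sigma>: "\<And>i. \<sigma> i \<in> trms \<Theta> X" "\<rho> = (\<lambda>i. cls \<Theta> X (\<sigma> i))" by metis
    have "l \<in> trms \<Theta> UNIV" "r \<in> trms \<Theta> UNIV" using lr \<Theta> unfolding is_variety_def by auto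
    then show ?thesis
      using teq.ident[OF lr, of \<sigma> X] \<sigma> by (auto simp: eval_W intro!: cls_eqI)
  qed
  then show ?thesis unfolding in_variety_def by (auto simp: W_ops_carrier)
qed

section \<open>Homomorphisms, in particular those out of free algebras\<close>

lemma Hom_closed: "h \<in> Hom \<Theta> A B \<Longrightarrow> a \<in> carrier A \<Longrightarrow> h a \<in> carrier B"
  unfolding Hom_def by auto

lemma Hom_ops:
  "h \<in> Hom \<Theta> A B \<Longrightarrow> length as = arity \<Theta> f \<Longrightarrow> set as \<subseteq> carrier A \<Longrightarrow>
    h (ops A f as) = ops B f (map h as)"
  unfolding Hom_def by blast

lemma Hom_W_eval:
  assumes h: "h \<in> Hom \<Theta> (W \<Theta> X) A" and "t \<in> trms \<Theta> X"
  shows "h (cls \<Theta> X t) = eval A (\<lambda>x. h (gen \<Theta> X x)) t"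
  using assms(2)
proof induction
  case (Op ts f)
  have ts: "set ts \<subseteq> trms \<Theta> X" using Op by auto
  have "h (cls \<Theta> X (Op f ts)) = h (ops (W \<Theta> X) f (map (cls \<Theta> X) ts))"
    using Op ts by (simp add: ops_W)
  also have "\<dots> = ops A f (map h (map (cls \<Theta> X) ts))"
    using Op(1) ts by (intro Hom_ops[OF h]) (auto simp: carrier_W)
  also have "map h (map (cls \<Theta> X) ts) = map (eval A (\<lambda>x. h (gen \<Theta> X x))) ts"
    using Op by auto
  finally show ?case by simp
qed simp

text \<open>The value at w can be computed from any term representing w, so only the generators in
  one such term matter. With all variables but one as Z, this is how the condition on
  \<open>supp\<close> is exploited later.\<close>

lemma Hom_W_eval_subset:
  assumes "h \<in> Hom \<Theta> (W \<Theta> X) A" "h' \<in> Hom \<Theta> (W \<Theta> X) A"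
    and "w \<in> cls \<Theta> X ` trms \<Theta> Z" "Z \<subseteq> X"
    and "\<And>x. x \<in> Z \<Longrightarrow> h (gen \<Theta> X x) = h' (gen \<Theta> X x)"
  shows "h w = h' w"
proof -
  obtain t where t: "t \<in> trms \<Theta> Z" "w = cls \<Theta> X t" using assms(3) by auto
  then have "t \<in> trms \<Theta> X" using trms_mono[OF assms(4)] by auto
  then show ?thesis
    using t tvars_trms[OF t(1)] assms
    by (auto simp: Hom_W_eval intro!: eval_cong_tvars)
qed

lemma Hom_W_ext:
  assumes "h \<in> Hom \<Theta> (W \<Theta> X) A" "h' \<in> Hom \<Theta> (W \<Theta> X) A"
    and "\<And>x. x \<in> X \<Longrightarrow> h (gen \<Theta> X x) = h' (gen \<Theta> X x)"
  shows "h = h'"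
proof (rule PiE_ext)
  show "h \<in> carrier (W \<Theta> X) \<rightarrow>\<^sub>E carrier A" "h' \<in> carrier (W \<Theta> X) \<rightarrow>\<^sub>E carrier A"
    using assms unfolding Hom_def by auto
  show "h w = h' w" if "w \<in> carrier (W \<Theta> X)" for w
    using Hom_W_eval_subset[OF assms(1,2), of w X] that assms(3) by (simp add: carrier_W)
qed

lemma W_free:
  assumes A: "in_variety \<Theta> A" and g: "\<And>x. x \<in> X \<Longrightarrow> g x \<in> carrier A"
  obtains h where "h \<in> Hom \<Theta> (W \<Theta> X) A" "\<And>x. x \<in> X \<Longrightarrow> h (gen \<Theta> X x) = g x"
proof
  \<comment> \<open>The value at a class is computed from a chosen representative; by
    \<open>eval_teq\<close> the choice does not matter. Outside the carrier the map is
    \<open>undefined\<close>, as the extensionality in \<open>Hom\<close> demands.\<close>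
  let ?h = "\<lambda>w\<in>carrier (W \<Theta> X). eval A g (SOME t. t \<in> w)"
  have h: "?h (cls \<Theta> X t) = eval A g t" if "t \<in> trms \<Theta> X" for t
    using eval_teq[where \<rho> = g, OF A g teq_some_cls[OF that]] that by (simp add: cls_carrier)
  show "?h (gen \<Theta> X x) = g x" if "x \<in> X" for x
    using h[OF trms.Var[OF that]] by simp
  show "?h \<in> Hom \<Theta> (W \<Theta> X) A"
    unfolding Hom_def
  proof (intro CollectI conjI allI impI)
    have "?h w \<in> carrier A" if "w \<in> carrier (W \<Theta> X)" for w
      using that h eval_carrier[where \<rho> = g, OF A g] unfolding carrier_W by force
    then show "?h \<in> carrier (W \<Theta> X) \<rightarrow>\<^sub>E carrier A" by auto
  next
    fix f ws assume ws: "length ws = arity \<Theta> f \<and> set ws \<subseteq> carrier (W \<Theta> X)"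
    then obtain ts where ts: "set ts \<subseteq> trms \<Theta> X" "ws = map (cls \<Theta> X) ts"
      by (meson W_list_reps)
    have "?h (ops (W \<Theta> X) f ws) = ?h (cls \<Theta> X (Op f ts))"
      using ws ts by (simp add: ops_W)
    also have "\<dots> = eval A g (Op f ts)"
      using ws ts by (intro h trms.Op) auto
    also have "\<dots> = ops A f (map ?h ws)"
      using ts h by (auto simp: subset_iff intro!: arg_cong[where f = "ops A f"] simp del: restrict_apply)
    finally show "?h (ops (W \<Theta> X) f ws) = ops A f (map ?h ws)" .
  qed
qed

text \<open>\<open>compose\<close> returns \<open>undefined\<close> outside
  \<open>carrier A\<close>; closure of A under its operations keeps \<open>ops A f as\<close>
  inside, so that the composite can be computed there.\<close>

lemma Hom_compose:
  assumes A: "\<And>f as. length as = arity \<Theta> f \<Longrightarrow> set as \<subseteq> carrier A \<Longrightarrow> ops A f as \<in> carrier A"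
    and g: "g \<in> Hom \<Theta> B C" and s: "s \<in> Hom \<Theta> A B"
  shows "compose (carrier A) g s \<in> Hom \<Theta> A C"
  unfolding Hom_def
proof (intro CollectI conjI allI impI)
  show "compose (carrier A) g s \<in> carrier A \<rightarrow>\<^sub>E carrier C"
    using Hom_closed[OF g] Hom_closed[OF s] by (auto simp: compose_def)
next
  fix f as assume as: "length as = arity \<Theta> f \<and> set as \<subseteq> carrier A"
  have "compose (carrier A) g s (ops A f as) = g (ops B f (map s as))"
    using as A Hom_ops[OF s] unfolding compose_def by auto
  also have "\<dots> = ops C f (map g (map s as))"
    using as Hom_closed[OF s] by (intro Hom_ops[OF g]) auto
  also have "map g (map s as) = map (compose (carrier A) g s) as"
    using as by (auto simp: compose_def)
  finally show "compose (carrier A) g s (ops A f as) = ops C f (map (compose (carrier A) g s) as)" .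
qed

lemma Hom_W_compose:
  "g \<in> Hom \<Theta> B C \<Longrightarrow> s \<in> Hom \<Theta> (W \<Theta> X) B \<Longrightarrow>
    compose (carrier (W \<Theta> X)) g s \<in> Hom \<Theta> (W \<Theta> X) C"
  by (rule Hom_compose) (rule W_ops_carrier)

text \<open>Freeness allows a point to be changed at a single variable. This is the source of the
  witnesses in the quantifier arguments below.\<close>

lemma Hom_W_update:
  assumes A: "in_variety \<Theta> A" and \<mu>: "\<mu> \<in> Hom \<Theta> (W \<Theta> X) A" and a: "a \<in> carrier A"
  obtains \<nu> where "\<nu> \<in> Hom \<Theta> (W \<Theta> X) A"
    "\<And>y. y \<in> X \<Longrightarrow> \<nu> (gen \<Theta> X y) = (if y = x then a else \<mu> (gen \<Theta> X y))"
  by (rule W_free[OF A, of X "\<lambda>y. if y = x then a else \<mu> (gen \<Theta> X y)"])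
    (use Hom_closed[OF \<mu> gen_carrier] a in auto)

section \<open>The Halmos algebra of an algebra\<close>

lemma hands_Hal:
  "hands (Hal \<Theta> H) X us = {\<mu> \<in> Hom \<Theta> (W \<Theta> X) H. \<forall>u \<in> set us. \<mu> \<in> u}"
  by (induction us) (auto simp: Hal_def)

lemma boolean_sort_Hal: "boolean_sort (Hal \<Theta> H) X"
  unfolding boolean_sort_def Hal_def by auto

lemma quantifier_sort_Hal:
  assumes H: "in_variety \<Theta> H"
  shows "quantifier_sort (Hal \<Theta> H) X"
proof -
  let ?E = "hex (Hal \<Theta> H) X"
  \<comment> \<open>One inclusion is enough, since x and y can be exchanged.\<close>
  have comm: "?E x (?E y a) \<subseteq> ?E y (?E x a)"
    if "x \<in> X" "y \<in> X" and a: "a \<in> car (Hal \<Theta> H) X" for x y a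
  proof
    fix \<mu> assume "\<mu> \<in> ?E x (?E y a)"
    then obtain \<nu> \<rho> where \<mu>: "\<mu> \<in> Hom \<Theta> (W \<Theta> X) H" and \<nu>: "\<nu> \<in> Hom \<Theta> (W \<Theta> X) H" and \<rho>: "\<rho> \<in> a"
      and \<mu>\<nu>: "\<forall>z\<in>X. z \<noteq> x \<longrightarrow> \<mu> (gen \<Theta> X z) = \<nu> (gen \<Theta> X z)"
      and \<nu>\<rho>: "\<forall>z\<in>X. z \<noteq> y \<longrightarrow> \<nu> (gen \<Theta> X z) = \<rho> (gen \<Theta> X z)"
      unfolding Hal_def by auto
    have "\<rho> \<in> Hom \<Theta> (W \<Theta> X) H" using \<rho> a unfolding Hal_def by auto
    then have "\<rho> (gen \<Theta> X y) \<in> carrier H"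
      using that by (auto intro: Hom_closed gen_carrier)
    \<comment> \<open>The new intermediate point follows \<mu> except at y, where it takes the value
      of \<rho>. It therefore differs from \<mu> at most at y and from \<rho> at most at x.\<close>
    then obtain \<nu>' where \<nu>': "\<nu>' \<in> Hom \<Theta> (W \<Theta> X) H"
      "\<And>z. z \<in> X \<Longrightarrow> \<nu>' (gen \<Theta> X z) = (if z = y then \<rho> (gen \<Theta> X y) else \<mu> (gen \<Theta> X z))"
      using Hom_W_update[OF H \<mu>, of "\<rho> (gen \<Theta> X y)" y] by blast
    have "\<forall>z\<in>X. z \<noteq> x \<longrightarrow> \<nu>' (gen \<Theta> X z) = \<rho> (gen \<Theta> X z)"
      using \<nu>' \<mu>\<nu> \<nu>\<rho> by auto
    then have "\<nu>' \<in> ?E x a" using \<nu>' \<rho> unfolding Hal_def by auto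
    moreover have "\<forall>z\<in>X. z \<noteq> y \<longrightarrow> \<mu> (gen \<Theta> X z) = \<nu>' (gen \<Theta> X z)"
      using \<nu>' by auto
    ultimately show "\<mu> \<in> ?E y (?E x a)" using \<mu> unfolding Hal_def by auto
  qed
  \<comment> \<open>Both inclusions rest on agreement off x being symmetric and transitive: two
    points that agree with \<mu> off x agree with each other off x.\<close>
  have meet: "?E x (a \<inter> ?E x b) = ?E x a \<inter> ?E x b"
    if "a \<in> car (Hal \<Theta> H) X" "b \<in> car (Hal \<Theta> H) X" for x a b
  proof (intro set_eqI iffI)
    fix \<mu> assume "\<mu> \<in> ?E x (a \<inter> ?E x b)"
    then obtain \<nu> \<rho> where "\<mu> \<in> Hom \<Theta> (W \<Theta> X) H" "\<nu> \<in> a" "\<rho> \<in> b"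
      "\<forall>y\<in>X. y \<noteq> x \<longrightarrow> \<mu> (gen \<Theta> X y) = \<nu> (gen \<Theta> X y)"
      "\<forall>y\<in>X. y \<noteq> x \<longrightarrow> \<nu> (gen \<Theta> X y) = \<rho> (gen \<Theta> X y)"
      unfolding Hal_def by auto
    then have "\<mu> \<in> Hom \<Theta> (W \<Theta> X) H" "\<exists>\<nu>\<in>a. \<forall>y\<in>X. y \<noteq> x \<longrightarrow> \<mu> (gen \<Theta> X y) = \<nu> (gen \<Theta> X y)"
      "\<exists>\<rho>\<in>b. \<forall>y\<in>X. y \<noteq> x \<longrightarrow> \<mu> (gen \<Theta> X y) = \<rho> (gen \<Theta> X y)"
      by (simp, blast, simp, blast)
    then show "\<mu> \<in> ?E x a \<inter> ?E x b" unfolding Hal_def by simp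
  next
    fix \<mu> assume "\<mu> \<in> ?E x a \<inter> ?E x b"
    then obtain \<nu> \<rho> where \<mu>: "\<mu> \<in> Hom \<Theta> (W \<Theta> X) H" "\<nu> \<in> a" "\<rho> \<in> b"
      "\<forall>y\<in>X. y \<noteq> x \<longrightarrow> \<mu> (gen \<Theta> X y) = \<nu> (gen \<Theta> X y)"
      "\<forall>y\<in>X. y \<noteq> x \<longrightarrow> \<mu> (gen \<Theta> X y) = \<rho> (gen \<Theta> X y)"
      unfolding Hal_def by auto
    have "\<nu> \<in> Hom \<Theta> (W \<Theta> X) H" using that \<mu>(2) unfolding Hal_def by auto
    moreover have "\<forall>y\<in>X. y \<noteq> x \<longrightarrow> \<nu> (gen \<Theta> X y) = \<rho> (gen \<Theta> X y)" using \<mu>(4,5) by simp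
    ultimately have "\<nu> \<in> a \<inter> ?E x b" using \<mu>(2,3) unfolding Hal_def by auto
    then show "\<mu> \<in> ?E x (a \<inter> ?E x b)" using \<mu>(1,4) unfolding Hal_def by auto
  qed
  have "?E x (?E y a) = ?E y (?E x a)" if "x \<in> X" "y \<in> X" "a \<in> car (Hal \<Theta> H) X" for x y a
    using comm[of x y a] comm[of y x a] that by auto
  moreover have "?E x a \<in> car (Hal \<Theta> H) X" "hand (Hal \<Theta> H) X a (?E x a) = a"
    "?E x (hbot (Hal \<Theta> H) X) = hbot (Hal \<Theta> H) X"
    if "a \<in> car (Hal \<Theta> H) X" for x a
    using that unfolding Hal_def by auto
  moreover have "hand (Hal \<Theta> H) X = (\<inter>)"
    unfolding Hal_def by auto
  moreover have "hbot (Hal \<Theta> H) X \<in> car (Hal \<Theta> H) X"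
    unfolding Hal_def by auto
  ultimately show ?thesis
    unfolding quantifier_sort_def using meet by simp
qed

lemma equality_sort_Hal: "equality_sort \<Theta> (Hal \<Theta> H) X"
proof -
  have "\<mu> (ops (W \<Theta> X) f ws) = \<mu> (ops (W \<Theta> X) f ws')"
    if len: "length ws = arity \<Theta> f" "length ws' = arity \<Theta> f"
      and ws: "set ws \<subseteq> carrier (W \<Theta> X)" "set ws' \<subseteq> carrier (W \<Theta> X)"
      and \<mu>: "\<mu> \<in> hands (Hal \<Theta> H) X (map2 (heq (Hal \<Theta> H) X) ws ws')" for f ws ws' \<mu>
  proof -
    have h: "\<mu> \<in> Hom \<Theta> (W \<Theta> X) H" using \<mu> by (simp add: hands_Hal)
    have "\<forall>u \<in> set (map2 (heq (Hal \<Theta> H) X) ws ws'). \<mu> \<in> u" using \<mu> by (simp add: hands_Hal)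
    then have "\<mu> \<in> heq (Hal \<Theta> H) X (ws ! i) (ws' ! i)" if "i < length ws" for i
      using len that by (fastforce simp: in_set_conv_nth)
    then have "map \<mu> ws = map \<mu> ws'"
      using len by (intro nth_equalityI) (auto simp: Hal_def)
    then show ?thesis using Hom_ops[OF h] len ws by metis
  qed
  then have le: "hands (Hal \<Theta> H) X (map2 (heq (Hal \<Theta> H) X) ws ws') \<subseteq>
      heq (Hal \<Theta> H) X (ops (W \<Theta> X) f ws) (ops (W \<Theta> X) f ws')"
    if "length ws = arity \<Theta> f" "length ws' = arity \<Theta> f"
      "set ws \<subseteq> carrier (W \<Theta> X)" "set ws' \<subseteq> carrier (W \<Theta> X)" for f ws ws'
    using that unfolding hands_Hal by (auto simp: Hal_def)
  have "hand (Hal \<Theta> H) X a b = a \<inter> b" for a b unfolding Hal_def by simp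
  then show ?thesis
    unfolding equality_sort_def using le by (auto simp: Hal_def Int_absorb2)
qed

lemma sub_boolean_hom_Hal: "sub_boolean_hom \<Theta> X0 (Hal \<Theta> H)"
  unfolding sub_boolean_hom_def Hal_def by (auto simp: Hom_W_compose)

lemma compose_restrict_id:
  "\<mu> \<in> Hom \<Theta> A B \<Longrightarrow> compose (carrier A) \<mu> (restrict id (carrier A)) = \<mu>"
  by (auto simp: compose_def Hom_def PiE_def extensional_def fun_eq_iff)

lemma compose_compose_Hom:
  "s \<in> Hom \<Theta> A B \<Longrightarrow>
    compose (carrier A) (compose (carrier B) \<mu> s') s = compose (carrier A) \<mu> (compose (carrier A) s' s)"
  using Hom_closed by (fastforce simp: compose_def fun_eq_iff)

lemma sub_functorial_Hal: "sub_functorial \<Theta> X0 (Hal \<Theta> H)"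
  unfolding sub_functorial_def Hal_def
  by (auto simp: Hom_W_compose compose_restrict_id compose_compose_Hom)

lemma compose_gen:
  "x \<in> X \<Longrightarrow> compose (carrier (W \<Theta> X)) \<mu> s (gen \<Theta> X x) = \<mu> (s (gen \<Theta> X x))"
  by (simp add: compose_eq gen_carrier)

lemma sub_quantifiers_Hal:
  fixes X0 :: "'v set"
  assumes H: "in_variety \<Theta> H"
  shows "sub_quantifiers \<Theta> X0 (Hal \<Theta> H)"
  unfolding sub_quantifiers_def
proof (intro conjI ballI impI)
  fix X Y :: "'v set" and x a s1 s2
  assume s: "s1 \<in> Hom \<Theta> (W \<Theta> X) (W \<Theta> Y)" "s2 \<in> Hom \<Theta> (W \<Theta> X) (W \<Theta> Y)"
    "\<forall>x'\<in>X. x' \<noteq> x \<longrightarrow> s1 (gen \<Theta> X x') = s2 (gen \<Theta> X x')"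
  show "hsub (Hal \<Theta> H) X Y s1 (hex (Hal \<Theta> H) X x a) = hsub (Hal \<Theta> H) X Y s2 (hex (Hal \<Theta> H) X x a)"
    using s unfolding Hal_def by (auto simp: Hom_W_compose compose_gen)
next
  fix X Y :: "'v set" and x y a s
  assume x: "x \<in> X" and y: "y \<in> Y" and a: "a \<in> car (Hal \<Theta> H) X"
    and s: "s \<in> Hom \<Theta> (W \<Theta> X) (W \<Theta> Y)"
    and sx: "s (gen \<Theta> X x) = gen \<Theta> Y y \<and>
      (\<forall>x'\<in>X. x' \<noteq> x \<longrightarrow> y \<notin> supp \<Theta> Y (s (gen \<Theta> X x')))"
  \<comment> \<open>Since y is in Y, its absence from \<open>supp\<close> means that the element is
    the class of some term without y.\<close>
  have avoid: "s (gen \<Theta> X z) \<in> cls \<Theta> Y ` trms \<Theta> (Y - {y})" if "z \<in> X" "z \<noteq> x" for z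
    using sx y that unfolding supp_def by blast
  have off: "\<mu> (s (gen \<Theta> X z)) = \<nu> (s (gen \<Theta> X z))"
    if "\<mu> \<in> Hom \<Theta> (W \<Theta> Y) H" "\<nu> \<in> Hom \<Theta> (W \<Theta> Y) H"
      "\<forall>v\<in>Y. v \<noteq> y \<longrightarrow> \<mu> (gen \<Theta> Y v) = \<nu> (gen \<Theta> Y v)" "z \<in> X" "z \<noteq> x" for \<mu> \<nu> z
    using Hom_W_eval_subset[OF that(1,2) avoid[OF that(4,5)]] that(3) by auto
  let ?c = "\<lambda>\<mu>. compose (carrier (W \<Theta> X)) \<mu> s"
  show "hsub (Hal \<Theta> H) X Y s (hex (Hal \<Theta> H) X x a) = hex (Hal \<Theta> H) Y y (hsub (Hal \<Theta> H) X Y s a)"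
  proof (intro set_eqI iffI)
    fix \<mu> assume "\<mu> \<in> hsub (Hal \<Theta> H) X Y s (hex (Hal \<Theta> H) X x a)"
    then obtain \<nu> where \<mu>: "\<mu> \<in> Hom \<Theta> (W \<Theta> Y) H" and \<nu>: "\<nu> \<in> a"
      and \<mu>\<nu>: "\<forall>z\<in>X. z \<noteq> x \<longrightarrow> \<mu> (s (gen \<Theta> X z)) = \<nu> (gen \<Theta> X z)"
      unfolding Hal_def by (auto simp: compose_gen)
    have \<nu>H: "\<nu> \<in> Hom \<Theta> (W \<Theta> X) H" using \<nu> a unfolding Hal_def by auto
    then have "\<nu> (gen \<Theta> X x) \<in> carrier H" using x by (auto intro: Hom_closed gen_carrier)
    \<comment> \<open>Moving \<mu> at y to the value of \<nu> at x makes its pullback along s equal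
      to \<nu>: s sends x to y, and the images of the other generators avoid y, so they keep the
      values they had under \<mu>.\<close>
    then obtain \<mu>' where \<mu>': "\<mu>' \<in> Hom \<Theta> (W \<Theta> Y) H"
      "\<And>z. z \<in> Y \<Longrightarrow> \<mu>' (gen \<Theta> Y z) = (if z = y then \<nu> (gen \<Theta> X x) else \<mu> (gen \<Theta> Y z))"
      using Hom_W_update[OF H \<mu>, of "\<nu> (gen \<Theta> X x)" y] by blast
    have "?c \<mu>' = \<nu>"
    proof (rule Hom_W_ext[OF Hom_W_compose[OF \<mu>'(1) s] \<nu>H])
      fix z assume z: "z \<in> X"
      show "?c \<mu>' (gen \<Theta> X z) = \<nu> (gen \<Theta> X z)"
      proof (cases "z = x")
        case True
        then show ?thesis using sx \<mu>'(2)[OF y] z by (simp add: compose_gen)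
      next
        case False
        then show ?thesis using off[OF \<mu>'(1) \<mu> _ z] \<mu>'(2) \<mu>\<nu> z by (simp add: compose_gen)
      qed
    qed
    then show "\<mu> \<in> hex (Hal \<Theta> H) Y y (hsub (Hal \<Theta> H) X Y s a)"
      using \<mu> \<mu>' \<nu> unfolding Hal_def by auto
  next
    fix \<mu> assume "\<mu> \<in> hex (Hal \<Theta> H) Y y (hsub (Hal \<Theta> H) X Y s a)"
    then obtain \<nu> where \<mu>: "\<mu> \<in> Hom \<Theta> (W \<Theta> Y) H" and \<nu>: "\<nu> \<in> Hom \<Theta> (W \<Theta> Y) H" "?c \<nu> \<in> a"
      and \<mu>\<nu>: "\<forall>z\<in>Y. z \<noteq> y \<longrightarrow> \<mu> (gen \<Theta> Y z) = \<nu> (gen \<Theta> Y z)"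
      unfolding Hal_def by auto
    then have "\<forall>z\<in>X. z \<noteq> x \<longrightarrow> ?c \<mu> (gen \<Theta> X z) = ?c \<nu> (gen \<Theta> X z)"
      using off[OF \<mu> \<nu>(1) \<mu>\<nu>] by (simp add: compose_gen)
    then show "\<mu> \<in> hsub (Hal \<Theta> H) X Y s (hex (Hal \<Theta> H) X x a)"
      using \<mu> \<nu>(2) s unfolding Hal_def by (auto simp: Hom_W_compose)
  qed
qed

lemma sub_equalities_Hal:
  fixes X0 :: "'v set"
  shows "sub_equalities \<Theta> X0 (Hal \<Theta> H)"
  unfolding sub_equalities_def
proof (intro conjI ballI impI)
  fix X Y :: "'v set" and s w w'
  assume "s \<in> Hom \<Theta> (W \<Theta> X) (W \<Theta> Y)" "w \<in> carrier (W \<Theta> X)" "w' \<in> carrier (W \<Theta> X)"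
  then show "hsub (Hal \<Theta> H) X Y s (heq (Hal \<Theta> H) X w w') = heq (Hal \<Theta> H) Y (s w) (s w')"
    unfolding Hal_def by (auto simp: Hom_W_compose compose_eq)
next
  fix X x a w w' s s'
  assume s: "s \<in> Hom \<Theta> (W \<Theta> X) (W \<Theta> X)" "s' \<in> Hom \<Theta> (W \<Theta> X) (W \<Theta> X)"
    and eq: "s (gen \<Theta> X x) = w \<and> s' (gen \<Theta> X x) = w' \<and>
      (\<forall>x'\<in>X. x' \<noteq> x \<longrightarrow> s (gen \<Theta> X x') = gen \<Theta> X x' \<and> s' (gen \<Theta> X x') = gen \<Theta> X x')"
  \<comment> \<open>s and s' differ at most at x, where they take the values w and w'; a point
    identifying w and w' has the same pullback along both.\<close>
  have "compose (carrier (W \<Theta> X)) \<mu> s = compose (carrier (W \<Theta> X)) \<mu> s'"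
    if "\<mu> \<in> Hom \<Theta> (W \<Theta> X) H" "\<mu> w = \<mu> w'" for \<mu>
  proof (rule Hom_W_ext[OF Hom_W_compose[OF that(1) s(1)] Hom_W_compose[OF that(1) s(2)]])
    fix z assume "z \<in> X"
    then show "compose (carrier (W \<Theta> X)) \<mu> s (gen \<Theta> X z) = compose (carrier (W \<Theta> X)) \<mu> s' (gen \<Theta> X z)"
      using eq that by (cases "z = x") (auto simp: compose_gen)
  qed
  then show "hle (Hal \<Theta> H) X (hand (Hal \<Theta> H) X (hsub (Hal \<Theta> H) X X s a) (heq (Hal \<Theta> H) X w w'))
      (hsub (Hal \<Theta> H) X X s' a)"
    unfolding Hal_def by auto
qed

lemma halmos_algebra_Hal:
  assumes "in_variety \<Theta> H"
  shows "halmos_algebra \<Theta> X0 (Hal \<Theta> H)"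
  unfolding halmos_algebra_def extended_boolean_def
  by (simp add: assms boolean_sort_Hal quantifier_sort_Hal equality_sort_Hal sub_boolean_hom_Hal
    sub_functorial_Hal sub_quantifiers_Hal sub_equalities_Hal)

section \<open>Homomorphisms and quotients\<close>

text \<open>Closure is separated from the axioms because it is also wanted for the term algebra,
  which is closed under the operations without being a Halmos algebra.\<close>

definition halmos_closed :: "'f variety \<Rightarrow> 'v set \<Rightarrow> ('f, 'v, 'a) halmos_str \<Rightarrow> bool" where
  "halmos_closed \<Theta> X0 A \<longleftrightarrow>
     (\<forall>X \<in> sorts X0.
        hbot A X \<in> car A X \<and> htop A X \<in> car A X \<and>
        (\<forall>a \<in> car A X. hneg A X a \<in> car A X) \<and>
        (\<forall>a \<in> car A X. \<forall>b \<in> car A X. hand A X a b \<in> car A X \<and> hor A X a b \<in> car A X) \<and>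
        (\<forall>x \<in> X. \<forall>a \<in> car A X. hex A X x a \<in> car A X) \<and>
        (\<forall>w \<in> carrier (W \<Theta> X). \<forall>w' \<in> carrier (W \<Theta> X). heq A X w w' \<in> car A X)) \<and>
     (\<forall>X \<in> sorts X0. \<forall>Y \<in> sorts X0. \<forall>s \<in> Hom \<Theta> (W \<Theta> X) (W \<Theta> Y). \<forall>a \<in> car A X.
        hsub A X Y s a \<in> car A Y)"

lemma halmos_closedD:
  assumes "halmos_closed \<Theta> X0 A" "X \<in> sorts X0"
  shows "hbot A X \<in> car A X" "htop A X \<in> car A X"
    "\<And>a. a \<in> car A X \<Longrightarrow> hneg A X a \<in> car A X"
    "\<And>a b. a \<in> car A X \<Longrightarrow> b \<in> car A X \<Longrightarrow> hand A X a b \<in> car A X"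
    "\<And>a b. a \<in> car A X \<Longrightarrow> b \<in> car A X \<Longrightarrow> hor A X a b \<in> car A X"
    "\<And>x a. x \<in> X \<Longrightarrow> a \<in> car A X \<Longrightarrow> hex A X x a \<in> car A X"
    "\<And>w w'. w \<in> carrier (W \<Theta> X) \<Longrightarrow> w' \<in> carrier (W \<Theta> X) \<Longrightarrow> heq A X w w' \<in> car A X"
    "\<And>Y s a. Y \<in> sorts X0 \<Longrightarrow> s \<in> Hom \<Theta> (W \<Theta> X) (W \<Theta> Y) \<Longrightarrow> a \<in> car A X \<Longrightarrow>
      hsub A X Y s a \<in> car A Y"
  using assms by (simp_all add: halmos_closed_def)

lemma hands_closed:
  assumes "halmos_closed \<Theta> X0 A" "X \<in> sorts X0" "set us \<subseteq> car A X"
  shows "hands A X us \<in> car A X"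
  using assms(3) by (induction us) (auto simp: halmos_closedD[OF assms(1,2)])

lemma halmos_algebra_closed:
  assumes A: "halmos_algebra \<Theta> X0 A"
  shows "halmos_closed \<Theta> X0 A"
proof -
  have "boolean_sort A X" "quantifier_sort A X" "equality_sort \<Theta> A X" if "X \<in> sorts X0" for X
    using A that unfolding halmos_algebra_def extended_boolean_def by simp_all
  moreover have "hbot A X \<in> car A X \<and> htop A X \<in> car A X \<and>
      (\<forall>a \<in> car A X. hneg A X a \<in> car A X) \<and>
      (\<forall>a \<in> car A X. \<forall>b \<in> car A X. hand A X a b \<in> car A X \<and> hor A X a b \<in> car A X)"
    if "boolean_sort A X" for X
    using that unfolding boolean_sort_def by (elim conjE) (intro conjI, assumption+, blast+)
  moreover have "\<forall>x \<in> X. \<forall>a \<in> car A X. hex A X x a \<in> car A X" if "quantifier_sort A X" for X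
    using that unfolding quantifier_sort_def by (elim conjE) blast
  moreover have "\<forall>w \<in> carrier (W \<Theta> X). \<forall>w' \<in> carrier (W \<Theta> X). heq A X w w' \<in> car A X"
    if "equality_sort \<Theta> A X" for X
    using that unfolding equality_sort_def by (elim conjE)
  moreover have "\<forall>X \<in> sorts X0. \<forall>Y \<in> sorts X0. \<forall>s \<in> Hom \<Theta> (W \<Theta> X) (W \<Theta> Y). \<forall>a \<in> car A X.
      hsub A X Y s a \<in> car A Y"
    using A unfolding halmos_algebra_def sub_boolean_hom_def by (elim conjE) blast
  ultimately show ?thesis unfolding halmos_closed_def by simp
qed

lemma halmos_homD:
  assumes "halmos_hom \<Theta> X0 A B h" "X \<in> sorts X0"
  shows "h X (hbot A X) = hbot B X" "h X (htop A X) = htop B X"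
    "\<And>a. a \<in> car A X \<Longrightarrow> h X a \<in> car B X"
    "\<And>a. a \<in> car A X \<Longrightarrow> h X (hneg A X a) = hneg B X (h X a)"
    "\<And>a b. a \<in> car A X \<Longrightarrow> b \<in> car A X \<Longrightarrow> h X (hand A X a b) = hand B X (h X a) (h X b)"
    "\<And>a b. a \<in> car A X \<Longrightarrow> b \<in> car A X \<Longrightarrow> h X (hor A X a b) = hor B X (h X a) (h X b)"
    "\<And>x a. x \<in> X \<Longrightarrow> a \<in> car A X \<Longrightarrow> h X (hex A X x a) = hex B X x (h X a)"
    "\<And>w w'. w \<in> carrier (W \<Theta> X) \<Longrightarrow> w' \<in> carrier (W \<Theta> X) \<Longrightarrow> h X (heq A X w w') = heq B X w w'"
    "\<And>Y s a. Y \<in> sorts X0 \<Longrightarrow> s \<in> Hom \<Theta> (W \<Theta> X) (W \<Theta> Y) \<Longrightarrow> a \<in> car A X \<Longrightarrow>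
      h Y (hsub A X Y s a) = hsub B X Y s (h X a)"
proof -
  have "h \<in> (\<Pi>\<^sub>E X \<in> sorts X0. car A X \<rightarrow>\<^sub>E car B X)"
    using assms(1) by (simp only: halmos_hom_def)
  then show "\<And>a. a \<in> car A X \<Longrightarrow> h X a \<in> car B X"
    using assms(2) by (blast dest: PiE_mem)
qed (use assms in \<open>simp_all add: halmos_hom_def\<close>)

lemma hom_hands:
  assumes "halmos_closed \<Theta> X0 A" "halmos_hom \<Theta> X0 A B h" "X \<in> sorts X0" "set us \<subseteq> car A X"
  shows "h X (hands A X us) = hands B X (map (h X) us)"
  using assms(4)
  by (induction us) (simp_all add: halmos_homD[OF assms(2,3)] hands_closed[OF assms(1,3)])

section \<open>Transfer of the Halmos axioms along injective homomorphisms\<close>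

text \<open>Apart from closure, every axiom is an equation (\<open>hle\<close> included), and its
  side conditions speak only of variables, elements of W(X) and homomorphisms, which A and B share.
  It holds in B at the images, and injectivity brings it back to A.\<close>

lemma halmos_algebra_inj_hom:
  fixes A :: "('f, 'v, 'a) halmos_str" and B :: "('f, 'v, 'b) halmos_str"
  assumes B: "halmos_algebra \<Theta> X0 B" and A: "halmos_closed \<Theta> X0 A"
    and h: "halmos_hom \<Theta> X0 A B h" and inj: "\<And>X. X \<in> sorts X0 \<Longrightarrow> inj_on (h X) (car A X)"
  shows "halmos_algebra \<Theta> X0 A"
proof -
  note cl = halmos_closedD[OF A] and hom = halmos_homD[OF h]
  have E: "a = b" if "X \<in> sorts X0" "a \<in> car A X" "b \<in> car A X" "h X a = h X b" for X a b
    using inj that by (auto dest: inj_onD)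
  have "boolean_sort A X" if X: "X \<in> sorts X0" for X
  proof -
    have "boolean_sort B X" using B X unfolding halmos_algebra_def extended_boolean_def by blast
    note b = this[unfolded boolean_sort_def]
    \<comment> \<open>Closure goals are solved outright. Each remaining equation is carried to B by
      \<open>E\<close>, h is pushed through the operations, and the axiom of B applies. The
      quantifier axioms follow the same scheme.\<close>
    show ?thesis
      unfolding boolean_sort_def
      by (intro conjI ballI;
        (simp add: cl X; fail)?; rule E[OF X]; (simp add: cl X; fail)?; simp add: hom cl X;
        use b hom(3)[OF X] in blast)
  qed
  moreover have "quantifier_sort A X" if X: "X \<in> sorts X0" for X
  proof -
    have "quantifier_sort B X" using B X unfolding halmos_algebra_def extended_boolean_def by blast
    note b = this[unfolded quantifier_sort_def]
    show ?thesis
      unfolding quantifier_sort_def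
      by (intro conjI ballI;
        (simp add: cl X; fail)?; rule E[OF X]; (simp add: cl X; fail)?; simp add: hom cl X;
        use b hom(3)[OF X] in blast)
  qed
  moreover have "equality_sort \<Theta> A X" if X: "X \<in> sorts X0" for X
  proof -
    have "equality_sort \<Theta> B X" using B X unfolding halmos_algebra_def extended_boolean_def by blast
    note b = this[unfolded equality_sort_def]
    have "hle A X (hands A X (map2 (heq A X) ws ws')) (heq A X (ops (W \<Theta> X) f ws) (ops (W \<Theta> X) f ws'))"
      if ws: "length ws = arity \<Theta> f" "length ws' = arity \<Theta> f"
        "set ws \<subseteq> carrier (W \<Theta> X)" "set ws' \<subseteq> carrier (W \<Theta> X)" for f ws ws'
    proof -
      have us: "set (map2 (heq A X) ws ws') \<subseteq> car A X"
        using ws by (auto intro!: cl(7)[OF X] dest: set_zip_leftD set_zip_rightD)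
      have c: "hands A X (map2 (heq A X) ws ws') \<in> car A X"
        by (rule hands_closed[OF A X us])
      have d: "heq A X (ops (W \<Theta> X) f ws) (ops (W \<Theta> X) f ws') \<in> car A X"
        using ws by (intro cl(7)[OF X] W_ops_carrier)
      have m: "map (h X) (map2 (heq A X) ws ws') = map2 (heq B X) ws ws'"
        using ws by (auto intro!: hom(8)[OF X] dest: set_zip_leftD set_zip_rightD)
      have e: "h X (hands A X (map2 (heq A X) ws ws')) = hands B X (map2 (heq B X) ws ws')"
        unfolding hom_hands[OF A h X us] m ..
      have "h X (heq A X (ops (W \<Theta> X) f ws) (ops (W \<Theta> X) f ws')) =
          heq B X (ops (W \<Theta> X) f ws) (ops (W \<Theta> X) f ws')"
        using ws by (intro hom(8)[OF X] W_ops_carrier)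
      then show ?thesis
        using b ws by (intro E[OF X cl(4)[OF X c d] c]) (simp add: hom(5)[OF X c d] e)
    qed
    moreover have "heq A X w w = htop A X" if "w \<in> carrier (W \<Theta> X)" for w
      using b that by (intro E[OF X]) (simp_all add: cl[OF X] hom[OF X])
    ultimately show ?thesis
      unfolding equality_sort_def using cl(7)[OF X] by blast
  qed
  moreover have "sub_boolean_hom \<Theta> X0 A"
  proof -
    have "sub_boolean_hom \<Theta> X0 B" using B unfolding halmos_algebra_def by blast
    note b = this[unfolded sub_boolean_hom_def]
    show ?thesis
      unfolding sub_boolean_hom_def
    proof (intro ballI)
      fix X Y s assume X: "X \<in> sorts X0" and Y: "Y \<in> sorts X0" and s: "s \<in> Hom \<Theta> (W \<Theta> X) (W \<Theta> Y)"
      note b = b[rule_format, OF X Y s]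
      show "hsub A X Y s (hbot A X) = hbot A Y \<and> hsub A X Y s (htop A X) = htop A Y \<and>
        (\<forall>a \<in> car A X. hsub A X Y s a \<in> car A Y \<and>
           hsub A X Y s (hneg A X a) = hneg A Y (hsub A X Y s a)) \<and>
        (\<forall>a \<in> car A X. \<forall>b \<in> car A X.
           hsub A X Y s (hand A X a b) = hand A Y (hsub A X Y s a) (hsub A X Y s b) \<and>
           hsub A X Y s (hor A X a b) = hor A Y (hsub A X Y s a) (hsub A X Y s b))"
        by (intro conjI ballI;
          (simp add: cl X Y s; fail)?; rule E[OF Y]; (simp add: cl X Y s; fail)?;
          simp add: hom cl X Y s; use b hom(3)[OF X] in blast)
    qed
  qed
  moreover have "sub_functorial \<Theta> X0 A"
  proof -
    have "sub_functorial \<Theta> X0 B" using B unfolding halmos_algebra_def by blast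
    note b = this[unfolded sub_functorial_def]
    \<comment> \<open>h commutes with \<open>hsub\<close> along homomorphisms, so the restricted
      identity has to be recognized as one.\<close>
    have id: "restrict id (carrier (W \<Theta> X)) \<in> Hom \<Theta> (W \<Theta> X) (W \<Theta> X)" for X :: "'v set"
      unfolding Hom_def by (auto simp: W_ops_carrier map_idI subset_iff)
    show ?thesis
      unfolding sub_functorial_def
    proof (intro conjI ballI)
      fix X a assume X: "X \<in> sorts X0" and a: "a \<in> car A X"
      show "hsub A X X (restrict id (carrier (W \<Theta> X))) a = a"
        using b hom(3)[OF X a] X
        by (intro E[OF X cl(8)[OF X X id a] a]) (simp add: hom(9)[OF X X id a])
    next
      fix X Y Z s s' a
      assume X: "X \<in> sorts X0" and Y: "Y \<in> sorts X0" and Z: "Z \<in> sorts X0" and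
        s: "s \<in> Hom \<Theta> (W \<Theta> X) (W \<Theta> Y)" "s' \<in> Hom \<Theta> (W \<Theta> Y) (W \<Theta> Z)" and a: "a \<in> car A X"
      note s3 = Hom_W_compose[OF s(2,1)]
      show "hsub A X Z (compose (carrier (W \<Theta> X)) s' s) a = hsub A Y Z s' (hsub A X Y s a)"
        by (rule E[OF Z]; (simp add: cl X Y Z s s3 a; fail)?;
          simp add: hom cl X Y Z s s3 a) (use b X Y Z s a hom(3)[OF X a] in blast)
    qed
  qed
  moreover have "sub_quantifiers \<Theta> X0 A"
  proof -
    have "sub_quantifiers \<Theta> X0 B" using B unfolding halmos_algebra_def by blast
    note b = this[unfolded sub_quantifiers_def]
    note b1 = b[THEN conjunct1, rule_format] and b2 = b[THEN conjunct2, rule_format]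
    show ?thesis
      unfolding sub_quantifiers_def
    proof (intro conjI ballI impI)
      fix X Y x a s1 s2
      assume X: "X \<in> sorts X0" and Y: "Y \<in> sorts X0" and x: "x \<in> X" and a: "a \<in> car A X"
        and s: "s1 \<in> Hom \<Theta> (W \<Theta> X) (W \<Theta> Y)" "s2 \<in> Hom \<Theta> (W \<Theta> X) (W \<Theta> Y)"
        and eq: "\<forall>x'\<in>X. x' \<noteq> x \<longrightarrow> s1 (gen \<Theta> X x') = s2 (gen \<Theta> X x')"
      have "hsub B X Y s1 (hex B X x (h X a)) = hsub B X Y s2 (hex B X x (h X a))"
        using eq by (intro b1[OF X Y x hom(3)[OF X a] s]) blast
      then show "hsub A X Y s1 (hex A X x a) = hsub A X Y s2 (hex A X x a)"
        by (intro E[OF Y]) (simp_all add: hom cl X Y x a s)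
    next
      fix X Y x y a s
      assume X: "X \<in> sorts X0" and Y: "Y \<in> sorts X0" and x: "x \<in> X" and y: "y \<in> Y"
        and a: "a \<in> car A X" and s: "s \<in> Hom \<Theta> (W \<Theta> X) (W \<Theta> Y)"
        and eq: "s (gen \<Theta> X x) = gen \<Theta> Y y \<and>
          (\<forall>x' \<in> X. x' \<noteq> x \<longrightarrow> y \<notin> supp \<Theta> Y (s (gen \<Theta> X x')))"
      have "hsub B X Y s (hex B X x (h X a)) = hex B Y y (hsub B X Y s (h X a))"
        using eq by (intro b2[OF X Y x y hom(3)[OF X a] s]) blast
      then show "hsub A X Y s (hex A X x a) = hex A Y y (hsub A X Y s a)"
        by (intro E[OF Y]) (simp_all add: hom cl X Y x y a s)
    qed
  qed
  moreover have "sub_equalities \<Theta> X0 A"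
  proof -
    have "sub_equalities \<Theta> X0 B" using B unfolding halmos_algebra_def by blast
    note b = this[unfolded sub_equalities_def]
    note b1 = b[THEN conjunct1, rule_format] and b2 = b[THEN conjunct2, rule_format]
    show ?thesis
      unfolding sub_equalities_def
    proof (intro conjI ballI impI)
      fix X Y s w w'
      assume X: "X \<in> sorts X0" and Y: "Y \<in> sorts X0" and s: "s \<in> Hom \<Theta> (W \<Theta> X) (W \<Theta> Y)"
        and w: "w \<in> carrier (W \<Theta> X)" "w' \<in> carrier (W \<Theta> X)"
      show "hsub A X Y s (heq A X w w') = heq A Y (s w) (s w')"
        by (intro E[OF Y]) (simp_all add: hom cl X Y s w Hom_closed[OF s] b1)
    next
      fix X x a w w' s s'
      assume X: "X \<in> sorts X0" and x: "x \<in> X" and a: "a \<in> car A X"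
        and w: "w \<in> carrier (W \<Theta> X)" "w' \<in> carrier (W \<Theta> X)"
        and s: "s \<in> Hom \<Theta> (W \<Theta> X) (W \<Theta> X)" "s' \<in> Hom \<Theta> (W \<Theta> X) (W \<Theta> X)"
        and eq: "s (gen \<Theta> X x) = w \<and> s' (gen \<Theta> X x) = w' \<and>
          (\<forall>x' \<in> X. x' \<noteq> x \<longrightarrow> s (gen \<Theta> X x') = gen \<Theta> X x' \<and> s' (gen \<Theta> X x') = gen \<Theta> X x')"
      have "hle B X (hand B X (hsub B X X s (h X a)) (heq B X w w')) (hsub B X X s' (h X a))"
        using eq by (intro b2[OF X x hom(3)[OF X a] w s]) blast
      then show "hle A X (hand A X (hsub A X X s a) (heq A X w w')) (hsub A X X s' a)"
        by (intro E[OF X]) (simp_all add: hom cl X w x a s)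
    qed
  qed
  ultimately show ?thesis
    unfolding halmos_algebra_def extended_boolean_def by blast
qed

section \<open>Congruences, quotients and kernels\<close>

lemma halmos_congruenceD:
  assumes "halmos_congruence \<Theta> X0 A \<theta>" "X \<in> sorts X0"
  shows "equiv (car A X) (\<theta> X)"
    "\<And>a b. (a, b) \<in> \<theta> X \<Longrightarrow> (hneg A X a, hneg A X b) \<in> \<theta> X"
    "\<And>a b c d. (a, b) \<in> \<theta> X \<Longrightarrow> (c, d) \<in> \<theta> X \<Longrightarrow> (hand A X a c, hand A X b d) \<in> \<theta> X"
    "\<And>a b c d. (a, b) \<in> \<theta> X \<Longrightarrow> (c, d) \<in> \<theta> X \<Longrightarrow> (hor A X a c, hor A X b d) \<in> \<theta> X"
    "\<And>x a b. x \<in> X \<Longrightarrow> (a, b) \<in> \<theta> X \<Longrightarrow> (hex A X x a, hex A X x b) \<in> \<theta> X"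
    "\<And>Y s a b. Y \<in> sorts X0 \<Longrightarrow> s \<in> Hom \<Theta> (W \<Theta> X) (W \<Theta> Y) \<Longrightarrow> (a, b) \<in> \<theta> X \<Longrightarrow>
      (hsub A X Y s a, hsub A X Y s b) \<in> \<theta> Y"
proof -
  have c: "equiv (car A X) (\<theta> X) \<and>
        (\<forall>(a, b) \<in> \<theta> X. (hneg A X a, hneg A X b) \<in> \<theta> X) \<and>
        (\<forall>(a, b) \<in> \<theta> X. \<forall>(c, d) \<in> \<theta> X.
           (hand A X a c, hand A X b d) \<in> \<theta> X \<and> (hor A X a c, hor A X b d) \<in> \<theta> X) \<and>
        (\<forall>x \<in> X. \<forall>(a, b) \<in> \<theta> X. (hex A X x a, hex A X x b) \<in> \<theta> X)"
    using assms unfolding halmos_congruence_def by (elim conjE) (erule (1) bspec)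
  have s: "\<forall>Y \<in> sorts X0. \<forall>s \<in> Hom \<Theta> (W \<Theta> X) (W \<Theta> Y).
      \<forall>(a, b) \<in> \<theta> X. (hsub A X Y s a, hsub A X Y s b) \<in> \<theta> Y"
    using assms unfolding halmos_congruence_def by (elim conjE) (erule (1) bspec)
  show "equiv (car A X) (\<theta> X)" using c by (elim conjE)
  show "(hneg A X a, hneg A X b) \<in> \<theta> X" if "(a, b) \<in> \<theta> X" for a b
    using c that by fastforce
  show "(hand A X a c, hand A X b d) \<in> \<theta> X" "(hor A X a c, hor A X b d) \<in> \<theta> X"
    if "(a, b) \<in> \<theta> X" "(c, d) \<in> \<theta> X" for a b c d
    using c that by (fastforce, fastforce)
  show "(hex A X x a, hex A X x b) \<in> \<theta> X" if "x \<in> X" "(a, b) \<in> \<theta> X" for x a b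
    using c that by fastforce
  show "(hsub A X Y s a, hsub A X Y s b) \<in> \<theta> Y"
    if "Y \<in> sorts X0" "s \<in> Hom \<Theta> (W \<Theta> X) (W \<Theta> Y)" "(a, b) \<in> \<theta> X" for Y s a b
    using s that by fastforce
qed

text \<open>The unions in \<open>quotient_str\<close> run over all representatives; compatibility of
  the operations with \<theta> makes the members of each union equal, so a single representative
  computes it.\<close>

lemma quotient_str_apply:
  assumes \<theta>: "halmos_congruence \<Theta> X0 A \<theta>" and X: "X \<in> sorts X0"
  shows "\<And>a. a \<in> car A X \<Longrightarrow> hneg (quotient_str A \<theta>) X (\<theta> X `` {a}) = \<theta> X `` {hneg A X a}"
    "\<And>a b. a \<in> car A X \<Longrightarrow> b \<in> car A X \<Longrightarrow>
      hand (quotient_str A \<theta>) X (\<theta> X `` {a}) (\<theta> X `` {b}) = \<theta> X `` {hand A X a b}"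
    "\<And>a b. a \<in> car A X \<Longrightarrow> b \<in> car A X \<Longrightarrow>
      hor (quotient_str A \<theta>) X (\<theta> X `` {a}) (\<theta> X `` {b}) = \<theta> X `` {hor A X a b}"
    "\<And>x a. x \<in> X \<Longrightarrow> a \<in> car A X \<Longrightarrow>
      hex (quotient_str A \<theta>) X x (\<theta> X `` {a}) = \<theta> X `` {hex A X x a}"
    "\<And>Y s a. Y \<in> sorts X0 \<Longrightarrow> s \<in> Hom \<Theta> (W \<Theta> X) (W \<Theta> Y) \<Longrightarrow> a \<in> car A X \<Longrightarrow>
      hsub (quotient_str A \<theta>) X Y s (\<theta> X `` {a}) = \<theta> Y `` {hsub A X Y s a}"
proof -
  note D = halmos_congruenceD[OF \<theta> X]
  note eq = equiv_class_eq[OF D(1)]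
  show "hneg (quotient_str A \<theta>) X (\<theta> X `` {a}) = \<theta> X `` {hneg A X a}" if "a \<in> car A X" for a
    unfolding quotient_str_def
    by (simp, rule UN_equiv_class[OF D(1) _ that]) (auto simp: congruent_def intro!: eq D)
  show "hex (quotient_str A \<theta>) X x (\<theta> X `` {a}) = \<theta> X `` {hex A X x a}"
    if "x \<in> X" "a \<in> car A X" for x a
    unfolding quotient_str_def
    by (simp, rule UN_equiv_class[OF D(1) _ that(2)]) (auto simp: congruent_def intro!: eq D that(1))
  show "hsub (quotient_str A \<theta>) X Y s (\<theta> X `` {a}) = \<theta> Y `` {hsub A X Y s a}"
    if "Y \<in> sorts X0" "s \<in> Hom \<Theta> (W \<Theta> X) (W \<Theta> Y)" "a \<in> car A X" for Y s a
    unfolding quotient_str_def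
    by (simp, rule UN_equiv_class[OF D(1) _ that(3)])
      (auto simp: congruent_def intro!: equiv_class_eq[OF halmos_congruenceD(1)[OF \<theta> that(1)]] D that)
  show "hand (quotient_str A \<theta>) X (\<theta> X `` {a}) (\<theta> X `` {b}) = \<theta> X `` {hand A X a b}"
    if "a \<in> car A X" "b \<in> car A X" for a b
    unfolding quotient_str_def
    by (simp, rule UN_equiv_class2[OF D(1) D(1) _ that]) (auto simp: congruent2_def intro!: eq D)
  show "hor (quotient_str A \<theta>) X (\<theta> X `` {a}) (\<theta> X `` {b}) = \<theta> X `` {hor A X a b}"
    if "a \<in> car A X" "b \<in> car A X" for a b
    unfolding quotient_str_def
    by (simp, rule UN_equiv_class2[OF D(1) D(1) _ that]) (auto simp: congruent2_def intro!: eq D)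
qed

lemma quotient_str_const:
  "car (quotient_str A \<theta>) X = car A X // \<theta> X"
  "hbot (quotient_str A \<theta>) X = \<theta> X `` {hbot A X}"
  "htop (quotient_str A \<theta>) X = \<theta> X `` {htop A X}"
  "heq (quotient_str A \<theta>) X w w' = \<theta> X `` {heq A X w w'}"
  by (simp_all add: quotient_str_def)

lemma quotient_closed:
  assumes A: "halmos_closed \<Theta> X0 A" and \<theta>: "halmos_congruence \<Theta> X0 A \<theta>"
  shows "halmos_closed \<Theta> X0 (quotient_str A \<theta>)"
  unfolding halmos_closed_def quotient_str_const
  by (auto elim!: quotientE simp: quotient_str_apply[OF \<theta>] intro!: quotientI halmos_closedD[OF A])

text \<open>The factorization part of the homomorphism theorem. \<theta> may be smaller than the
  kernel of g, which is the situation for the verbal congruence.\<close>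

lemma quotient_induced_hom:
  assumes A: "halmos_closed \<Theta> X0 A" and \<theta>: "halmos_congruence \<Theta> X0 A \<theta>"
    and g: "halmos_hom \<Theta> X0 A B g"
    and ker: "\<And>X a b. X \<in> sorts X0 \<Longrightarrow> (a, b) \<in> \<theta> X \<Longrightarrow> g X a = g X b"
  obtains h where "halmos_hom \<Theta> X0 (quotient_str A \<theta>) B h"
    "\<And>X a. X \<in> sorts X0 \<Longrightarrow> a \<in> car A X \<Longrightarrow> h X (\<theta> X `` {a}) = g X a"
proof
  let ?h = "\<lambda>X\<in>sorts X0. \<lambda>c\<in>car A X // \<theta> X. g X (SOME a. a \<in> c)"
  show h: "?h X (\<theta> X `` {a}) = g X a" if X: "X \<in> sorts X0" and a: "a \<in> car A X" for X a
  proof -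
    have "a \<in> \<theta> X `` {a}" using equiv_class_self[OF halmos_congruenceD(1)[OF \<theta> X] a] .
    then have "(SOME b. b \<in> \<theta> X `` {a}) \<in> \<theta> X `` {a}" by (rule someI)
    then have "g X (SOME b. b \<in> \<theta> X `` {a}) = g X a" using ker[OF X] by (metis Image_singleton_iff)
    then show ?thesis using X a by (simp add: quotientI)
  qed
  have E: "\<exists>a\<in>car A X. c = \<theta> X `` {a}" if "c \<in> car A X // \<theta> X" for X c
    using that by (auto elim: quotientE)
  note q = quotient_str_apply[OF \<theta>] and cl = halmos_closedD[OF A] and hom = halmos_homD[OF g]
  show "halmos_hom \<Theta> X0 (quotient_str A \<theta>) B ?h"
    unfolding halmos_hom_def quotient_str_const
  proof (intro conjI ballI)
    show "?h \<in> (\<Pi>\<^sub>E X \<in> sorts X0. car A X // \<theta> X \<rightarrow>\<^sub>E car B X)"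
    proof (intro restrict_PiE_iff[THEN iffD2] ballI)
      fix X c assume X: "X \<in> sorts X0" and c: "c \<in> car A X // \<theta> X"
      obtain a where a: "a \<in> car A X" "c = \<theta> X `` {a}" using E[OF c] by blast
      show "g X (SOME a. a \<in> c) \<in> car B X"
        using h[OF X a(1)] hom(3)[OF X a(1)] X c a(2) by simp
    qed
  next
    fix X assume X: "X \<in> sorts X0"
    note S = q[OF X] h[OF X] cl[OF X] hom[OF X]
    show "?h X (\<theta> X `` {hbot A X}) = hbot B X" "?h X (\<theta> X `` {htop A X}) = htop B X"
      by (simp_all add: S del: restrict_apply)
    show "?h X (\<theta> X `` {heq A X w w'}) = heq B X w w'"
      if "w \<in> carrier (W \<Theta> X)" "w' \<in> carrier (W \<Theta> X)" for w w'
      using that by (simp add: S del: restrict_apply)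
    fix c assume c: "c \<in> car A X // \<theta> X"
    obtain a where a: "a \<in> car A X" "c = \<theta> X `` {a}" using E[OF c] by blast
    show "?h X (hneg (quotient_str A \<theta>) X c) = hneg B X (?h X c)"
      using a by (simp add: S del: restrict_apply)
    show "?h X (hex (quotient_str A \<theta>) X x c) = hex B X x (?h X c)" if "x \<in> X" for x
      using a that by (simp add: S del: restrict_apply)
    show "?h Y (hsub (quotient_str A \<theta>) X Y s c) = hsub B X Y s (?h X c)"
      if "Y \<in> sorts X0" "s \<in> Hom \<Theta> (W \<Theta> X) (W \<Theta> Y)" for Y s
      using a that by (simp add: S h[OF that(1)] del: restrict_apply)
    fix d assume d: "d \<in> car A X // \<theta> X"
    obtain b where b: "b \<in> car A X" "d = \<theta> X `` {b}" using E[OF d] by blast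
    show "?h X (hand (quotient_str A \<theta>) X c d) = hand B X (?h X c) (?h X d)"
      "?h X (hor (quotient_str A \<theta>) X c d) = hor B X (?h X c) (?h X d)"
      using a b by (simp_all add: S del: restrict_apply)
  qed
qed

definition hom_kernel ::
  "('f, 'v, 'a) halmos_str \<Rightarrow> ('v set \<Rightarrow> 'a \<Rightarrow> 'b) \<Rightarrow> 'v set \<Rightarrow> ('a \<times> 'a) set" where
  "hom_kernel A h X = {(a, b). a \<in> car A X \<and> b \<in> car A X \<and> h X a = h X b}"

lemma hom_kernel_congruence:
  assumes A: "halmos_closed \<Theta> X0 A" and h: "halmos_hom \<Theta> X0 A B h"
  shows "halmos_congruence \<Theta> X0 A (hom_kernel A h)"
proof -
  have "equiv (car A X) (hom_kernel A h X)" for X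
    unfolding hom_kernel_def by (auto simp: equiv_def refl_on_def sym_def trans_def)
  then show ?thesis
    unfolding halmos_congruence_def
    by (auto simp: hom_kernel_def halmos_homD[OF h] halmos_closedD[OF A])
qed

text \<open>The map induced on the quotient by the kernel is injective, so the quotient inherits the
  axioms of B.\<close>

lemma hom_kernel_quotient:
  assumes A: "halmos_closed \<Theta> X0 A" and B: "halmos_algebra \<Theta> X0 B" and g: "halmos_hom \<Theta> X0 A B g"
  shows "halmos_algebra \<Theta> X0 (quotient_str A (hom_kernel A g))"
proof -
  let ?\<theta> = "hom_kernel A g"
  note \<theta> = hom_kernel_congruence[OF A g]
  obtain h where h: "halmos_hom \<Theta> X0 (quotient_str A ?\<theta>) B h"
    "\<And>X a. X \<in> sorts X0 \<Longrightarrow> a \<in> car A X \<Longrightarrow> h X (?\<theta> X `` {a}) = g X a"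
    using quotient_induced_hom[OF A \<theta> g] by (auto simp: hom_kernel_def)
  show ?thesis
  proof (rule halmos_algebra_inj_hom[OF B quotient_closed[OF A \<theta>] h(1)])
    fix X assume X: "X \<in> sorts X0"
    show "inj_on (h X) (car (quotient_str A ?\<theta>) X)"
      unfolding quotient_str_const
    proof (rule inj_onI)
      fix c d assume "c \<in> car A X // ?\<theta> X" "d \<in> car A X // ?\<theta> X" and eq: "h X c = h X d"
      then obtain a b where ab: "a \<in> car A X" "c = ?\<theta> X `` {a}" "b \<in> car A X" "d = ?\<theta> X `` {b}"
        by (auto elim!: quotientE)
      then have "(a, b) \<in> ?\<theta> X" using eq h(2)[OF X] by (simp add: hom_kernel_def)
      then show "c = d" using ab equiv_class_eq[OF halmos_congruenceD(1)[OF \<theta> X]] by simp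
    qed
  qed
qed

text \<open>Nonemptiness of S matters: an empty intersection would be the universal relation on the
  whole type instead of a relation on the carrier.\<close>

lemma halmos_congruence_Inter:
  assumes "S \<noteq> {}" "\<And>\<theta>. \<theta> \<in> S \<Longrightarrow> halmos_congruence \<Theta> X0 A \<theta>"
  shows "halmos_congruence \<Theta> X0 A (\<lambda>X. \<Inter>\<theta>\<in>S. \<theta> X)"
proof -
  note D = halmos_congruenceD[OF assms(2)]
  have "equiv (car A X) (\<Inter>\<theta>\<in>S. \<theta> X)" if "X \<in> sorts X0" for X
  proof -
    have e: "\<theta> X \<subseteq> car A X \<times> car A X" "refl_on (car A X) (\<theta> X)" "sym (\<theta> X)" "trans (\<theta> X)"
      if "\<theta> \<in> S" for \<theta>
      using D(1)[OF that \<open>X \<in> sorts X0\<close>] by (auto simp: equiv_def refl_on_def)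
    have "(\<Inter>\<theta>\<in>S. \<theta> X) \<subseteq> car A X \<times> car A X" using e(1) assms(1) by blast
    moreover have "refl_on (car A X) (\<Inter>\<theta>\<in>S. \<theta> X)"
      using e(2) assms(1) unfolding refl_on_def by blast
    moreover have "sym (\<Inter>\<theta>\<in>S. \<theta> X)" using e(3) by (auto intro!: symI dest: symD)
    moreover have "trans (\<Inter>\<theta>\<in>S. \<theta> X)"
      using e(4) by (intro transI) (blast dest: transD)
    ultimately show ?thesis by (simp add: equiv_def)
  qed
  then show ?thesis
    unfolding halmos_congruence_def by (auto intro: D)
qed

section \<open>The universal property of the algebra of formulas\<close>

lemma term_str_closed: "halmos_closed \<Theta> X0 (term_str \<Theta> X0)"
  unfolding halmos_closed_def term_str_def by (auto intro: hterms.intros)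

text \<open>The constructors do not record the sort of a term, apart from the source sort kept in
  \<open>HSub\<close>. The sort is therefore an argument, which changes to the source when an
  \<open>HSub\<close> is entered.\<close>

primrec interp :: "('f, 'v, 'a) halmos_str \<Rightarrow> ('f, 'v) hterm \<Rightarrow> 'v set \<Rightarrow> 'a" where
  "interp B (HEq w w') X = heq B X w w'"
| "interp B HBot X = hbot B X"
| "interp B HTop X = htop B X"
| "interp B (HNeg u) X = hneg B X (interp B u X)"
| "interp B (HAnd u v) X = hand B X (interp B u X) (interp B v X)"
| "interp B (HOr u v) X = hor B X (interp B u X) (interp B v X)"
| "interp B (HEx x u) X = hex B X x (interp B u X)"
| "interp B (HSub Y s u) X = hsub B Y X s (interp B u Y)"

lemma hterms_sort: "(X, u) \<in> hterms \<Theta> X0 \<Longrightarrow> X \<in> sorts X0"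
  by (induction X u rule: hterms.induct) auto

lemma interp_closed:
  assumes "halmos_closed \<Theta> X0 B" "(X, u) \<in> hterms \<Theta> X0"
  shows "interp B u X \<in> car B X"
  using assms(2)
  by (induction X u rule: hterms.induct) (auto simp: halmos_closedD[OF assms(1)] dest: hterms_sort)

lemma interp_hom:
  assumes "halmos_closed \<Theta> X0 B"
  shows "halmos_hom \<Theta> X0 (term_str \<Theta> X0) B
    (\<lambda>X\<in>sorts X0. \<lambda>u\<in>car (term_str \<Theta> X0) X. interp B u X)"
  unfolding halmos_hom_def term_str_def
  by (auto intro: hterms.intros simp: interp_closed[OF assms])

text \<open>The index set of the intersection no longer depends on the sort, which is the form that
  \<open>halmos_congruence_Inter\<close> expects.\<close>

lemma verbal_congruence_eq:
  "verbal_congruence \<Theta> X0 = (\<lambda>X. \<Inter>\<theta>\<in>{\<theta>. halmos_congruence \<Theta> X0 (term_str \<Theta> X0) \<theta> \<and>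
     halmos_algebra \<Theta> X0 (quotient_str (term_str \<Theta> X0) \<theta>)}. \<theta> X)"
  unfolding verbal_congruence_def by (auto simp: fun_eq_iff)

text \<open>The kernel of the interpretation in B is a member of the intersected family. For the
  first claim, where B does not occur, this keeps the family nonempty; for the second it bounds the
  intersection from above.\<close>

lemma verbal_congruence:
  assumes B: "halmos_algebra \<Theta> X0 B"
  shows "halmos_congruence \<Theta> X0 (term_str \<Theta> X0) (verbal_congruence \<Theta> X0)"
    and "\<And>X u v. X \<in> sorts X0 \<Longrightarrow> (u, v) \<in> verbal_congruence \<Theta> X0 X \<Longrightarrow> interp B u X = interp B v X"
proof -
  let ?g = "\<lambda>X\<in>sorts X0. \<lambda>u\<in>car (term_str \<Theta> X0) X. interp B u X"
  let ?P = "\<lambda>\<theta>. halmos_congruence \<Theta> X0 (term_str \<Theta> X0) \<theta> \<and>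
     halmos_algebra \<Theta> X0 (quotient_str (term_str \<Theta> X0) \<theta>)"
  note g = interp_hom[OF halmos_algebra_closed[OF B]]
  have P: "?P (hom_kernel (term_str \<Theta> X0) ?g)"
    using hom_kernel_congruence[OF term_str_closed g] hom_kernel_quotient[OF term_str_closed B g] by blast
  show "halmos_congruence \<Theta> X0 (term_str \<Theta> X0) (verbal_congruence \<Theta> X0)"
    unfolding verbal_congruence_eq by (rule halmos_congruence_Inter) (use P in blast)+
  fix X u v assume X: "X \<in> sorts X0" and "(u, v) \<in> verbal_congruence \<Theta> X0 X"
  then have "(u, v) \<in> hom_kernel (term_str \<Theta> X0) ?g X"
    using P unfolding verbal_congruence_eq by blast
  then show "interp B u X = interp B v X"
    using X by (auto simp: hom_kernel_def)
qed

text \<open>\<Phi> is generated by the equalities, so a homomorphism has no freedom: by induction on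
  the term it must follow the interpretation.\<close>

lemma \<Phi>_hom_interp:
  assumes B: "halmos_algebra \<Theta> X0 B" and h: "halmos_hom \<Theta> X0 (\<Phi> \<Theta> X0) B h"
    and u: "(X, u) \<in> hterms \<Theta> X0"
  shows "h X (verbal_congruence \<Theta> X0 X `` {u}) = interp B u X"
proof -
  let ?V = "verbal_congruence \<Theta> X0"
  note hom = halmos_homD[OF h, unfolded \<Phi>_def quotient_str_const]
  note q = quotient_str_apply[OF verbal_congruence(1)[OF B], symmetric]
  have t: "u \<in> car (term_str \<Theta> X0) X \<longleftrightarrow> (X, u) \<in> hterms \<Theta> X0"
    "(X, u) \<in> hterms \<Theta> X0 \<Longrightarrow> ?V X `` {u} \<in> car (term_str \<Theta> X0) X // ?V X" for X u
    by (auto simp: term_str_def intro!: quotientI)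
  have ops: "hbot (term_str \<Theta> X0) X = HBot" "htop (term_str \<Theta> X0) X = HTop"
    "hneg (term_str \<Theta> X0) X = HNeg" "hand (term_str \<Theta> X0) X = HAnd" "hor (term_str \<Theta> X0) X = HOr"
    "hex (term_str \<Theta> X0) X = HEx" "heq (term_str \<Theta> X0) X = HEq" "hsub (term_str \<Theta> X0) X Y = HSub X" for X Y
    by (simp_all add: term_str_def)
  note q = q[unfolded ops t(1)] and hom = hom[unfolded ops]
  show ?thesis
    using u
  proof (induction X u rule: hterms.induct)
    case (HEq X w w')
    then show ?case using hom(8) by simp
  next
    case (HBot X)
    then show ?case using hom(1) by simp
  next
    case (HTop X)
    then show ?case using hom(2) by simp
  next
    case (HNeg X u)
    note X = hterms_sort[OF HNeg(1)]
    show ?case using HNeg by (simp add: q(1)[OF X] hom(4)[OF X] t)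
  next
    case (HAnd X u v)
    note X = hterms_sort[OF HAnd(1)]
    show ?case using HAnd by (simp add: q(2)[OF X] hom(5)[OF X] t)
  next
    case (HOr X u v)
    note X = hterms_sort[OF HOr(1)]
    show ?case using HOr by (simp add: q(3)[OF X] hom(6)[OF X] t)
  next
    case (HEx x X u)
    note X = hterms_sort[OF HEx(2)]
    show ?case using HEx by (simp add: q(4)[OF X] hom(7)[OF X] t)
  next
    case (HSub Y s X u)
    note X = hterms_sort[OF HSub(3)]
    show ?case using HSub by (simp add: q(5)[OF X] hom(9)[OF X] t)
  qed
qed

text \<open>This gives the definite description in \<open>Val\<close> its meaning. The
  interpretation of terms factors through the verbal congruence; uniqueness holds because every
  element is the class of a term and homomorphisms are extensional in the sort and in the
  element.\<close>

lemma \<Phi>_free: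
  assumes B: "halmos_algebra \<Theta> X0 B"
  shows "\<exists>!h. halmos_hom \<Theta> X0 (\<Phi> \<Theta> X0) B h"
proof -
  let ?V = "verbal_congruence \<Theta> X0"
  let ?g = "\<lambda>X\<in>sorts X0. \<lambda>u\<in>car (term_str \<Theta> X0) X. interp B u X"
  have "?g X u = ?g X v" if X: "X \<in> sorts X0" and uv: "(u, v) \<in> ?V X" for X u v
  proof -
    \<comment> \<open>\<open>?g\<close> is restricted to the carriers, so u and v must be known to
      lie there before its values are those of \<open>interp\<close>.\<close>
    have "u \<in> car (term_str \<Theta> X0) X" "v \<in> car (term_str \<Theta> X0) X"
      using halmos_congruenceD(1)[OF verbal_congruence(1)[OF B] X] uv by (auto simp: equiv_def refl_on_def)
    then show ?thesis using verbal_congruence(2)[OF B X uv] X by simp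
  qed
  then obtain h where h: "halmos_hom \<Theta> X0 (\<Phi> \<Theta> X0) B h"
    unfolding \<Phi>_def
    using quotient_induced_hom[OF term_str_closed verbal_congruence(1)[OF B]
      interp_hom[OF halmos_algebra_closed[OF B]]] by blast
  moreover have "h1 = h2"
    if h1: "halmos_hom \<Theta> X0 (\<Phi> \<Theta> X0) B h1" and h2: "halmos_hom \<Theta> X0 (\<Phi> \<Theta> X0) B h2" for h1 h2
  proof (rule PiE_ext)
    show e: "h1 \<in> (\<Pi>\<^sub>E X \<in> sorts X0. car (\<Phi> \<Theta> X0) X \<rightarrow>\<^sub>E car B X)"
      "h2 \<in> (\<Pi>\<^sub>E X \<in> sorts X0. car (\<Phi> \<Theta> X0) X \<rightarrow>\<^sub>E car B X)"
      using h1 h2 by (simp_all only: halmos_hom_def)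
    fix X assume X: "X \<in> sorts X0"
    show "h1 X = h2 X"
    proof (rule PiE_ext[OF PiE_mem[OF e(1) X] PiE_mem[OF e(2) X]])
      fix c assume "c \<in> car (\<Phi> \<Theta> X0) X"
      then obtain u where "(X, u) \<in> hterms \<Theta> X0" "c = ?V X `` {u}"
        unfolding \<Phi>_def quotient_str_const by (auto elim: quotientE simp: term_str_def)
      then show "h1 X c = h2 X c" using \<Phi>_hom_interp[OF B h1] \<Phi>_hom_interp[OF B h2] by simp
    qed
  qed
  ultimately show ?thesis by blast
qed

lemma Val_hom: "in_variety \<Theta> H \<Longrightarrow> halmos_hom \<Theta> X0 (\<Phi> \<Theta> X0) (Hal \<Theta> H) (Val \<Theta> X0 H)"
  unfolding Val_def by (rule theI'[OF \<Phi>_free[OF halmos_algebra_Hal]])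

text \<open>H enters through \<open>Hal \<Theta> H\<close>, a Halmos algebra that certifies the
  verbal congruence to be a congruence.\<close>

lemma \<Phi>_closed:
  assumes "in_variety \<Theta> H"
  shows "halmos_closed \<Theta> X0 (\<Phi> \<Theta> X0)"
  unfolding \<Phi>_def
  by (rule quotient_closed[OF term_str_closed verbal_congruence(1)[OF halmos_algebra_Hal[OF assms]]])

section \<open>Special formulas and types\<close>

lemma fo_class_car:
  assumes "halmos_closed \<Theta> X0 (\<Phi> \<Theta> X0)" "fo_over \<Theta> X0 p"
  shows "fo_class \<Theta> X0 p \<in> car (\<Phi> \<Theta> X0) X0"
proof -
  have "X0 \<in> sorts X0" by (simp add: sorts_def)
  then show ?thesis
    using assms(2) by (induction p) (simp_all add: halmos_closedD[OF assms(1)] cls_carrier)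
qed

lemma fo_over_free_vars: "fo_over \<Theta> X0 p \<Longrightarrow> free_vars p \<subseteq> X0"
  by (induction p) (auto dest: tvars_trms)

text \<open>The coincidence lemma of first-order logic. As \<open>Val\<close> is a homomorphism into
  \<open>Hal\<close>, connectives become set operations on points; both points vary in the induction
  for the sake of the quantifier.\<close>

lemma Val_fo_class_cong:
  assumes H: "in_variety \<Theta> H" and "fo_over \<Theta> X0 p"
    and "\<eta> \<in> Hom \<Theta> (W \<Theta> X0) H" "\<eta>' \<in> Hom \<Theta> (W \<Theta> X0) H"
    and "\<And>x. x \<in> free_vars p \<Longrightarrow> \<eta> (gen \<Theta> X0 x) = \<eta>' (gen \<Theta> X0 x)"
  shows "\<eta> \<in> Val \<Theta> X0 H X0 (fo_class \<Theta> X0 p) \<longleftrightarrow> \<eta>' \<in> Val \<Theta> X0 H X0 (fo_class \<Theta> X0 p)"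
proof -
  have X0: "X0 \<in> sorts X0" by (simp add: sorts_def)
  note val = halmos_homD[OF Val_hom[OF H] X0] and car = fo_class_car[OF \<Phi>_closed[OF H]]
  show ?thesis
    using assms(2-)
  proof (induction p arbitrary: \<eta> \<eta>')
    case (FEq t t')
    have "\<eta> (cls \<Theta> X0 r) = \<eta>' (cls \<Theta> X0 r)" if "r = t \<or> r = t'" for r
    proof -
      have "r \<in> trms \<Theta> X0" "\<And>x. x \<in> tvars r \<Longrightarrow> \<eta> (gen \<Theta> X0 x) = \<eta>' (gen \<Theta> X0 x)"
        using that FEq by auto
      then show ?thesis
        using FEq(2,3) by (simp add: Hom_W_eval) (rule eval_cong_tvars)
    qed
    then show ?case using FEq by (simp add: val cls_carrier) (simp add: Hal_def)
  next
    case (FNeg p)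
    have "\<eta> \<in> Val \<Theta> X0 H X0 (fo_class \<Theta> X0 p) \<longleftrightarrow> \<eta>' \<in> Val \<Theta> X0 H X0 (fo_class \<Theta> X0 p)"
      using FNeg.prems by (intro FNeg.IH) auto
    then show ?case using FNeg.prems by (simp add: val car) (simp add: Hal_def)
  next
    case (FAnd p q)
    have "\<eta> \<in> Val \<Theta> X0 H X0 (fo_class \<Theta> X0 p) \<longleftrightarrow> \<eta>' \<in> Val \<Theta> X0 H X0 (fo_class \<Theta> X0 p)"
      using FAnd.prems by (intro FAnd.IH(1)) auto
    moreover have "\<eta> \<in> Val \<Theta> X0 H X0 (fo_class \<Theta> X0 q) \<longleftrightarrow> \<eta>' \<in> Val \<Theta> X0 H X0 (fo_class \<Theta> X0 q)"
      using FAnd.prems by (intro FAnd.IH(2)) auto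
    ultimately show ?case using FAnd.prems by (simp add: val car) (simp add: Hal_def)
  next
    case (FOr p q)
    have "\<eta> \<in> Val \<Theta> X0 H X0 (fo_class \<Theta> X0 p) \<longleftrightarrow> \<eta>' \<in> Val \<Theta> X0 H X0 (fo_class \<Theta> X0 p)"
      using FOr.prems by (intro FOr.IH(1)) auto
    moreover have "\<eta> \<in> Val \<Theta> X0 H X0 (fo_class \<Theta> X0 q) \<longleftrightarrow> \<eta>' \<in> Val \<Theta> X0 H X0 (fo_class \<Theta> X0 q)"
      using FOr.prems by (intro FOr.IH(2)) auto
    ultimately show ?case using FOr.prems by (simp add: val car) (simp add: Hal_def)
  next
    case (FEx x p)
    let ?A = "Val \<Theta> X0 H X0 (fo_class \<Theta> X0 p)"
    have x: "x \<in> X0" and p: "fo_over \<Theta> X0 p" using FEx.prems by auto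
    have A: "?A \<subseteq> Hom \<Theta> (W \<Theta> X0) H"
      using val(3)[OF car[OF p]] by (simp add: Hal_def)
    \<comment> \<open>One implication for arbitrary points; used in both directions it gives the
      equivalence.\<close>
    have step: "\<mu>' \<in> hex (Hal \<Theta> H) X0 x ?A"
      if \<mu>: "\<mu> \<in> hex (Hal \<Theta> H) X0 x ?A" and \<mu>': "\<mu>' \<in> Hom \<Theta> (W \<Theta> X0) H"
        and eq: "\<And>y. y \<in> free_vars p - {x} \<Longrightarrow> \<mu> (gen \<Theta> X0 y) = \<mu>' (gen \<Theta> X0 y)"
      for \<mu> \<mu>'
    proof -
      obtain \<nu> where \<nu>: "\<nu> \<in> ?A" "\<forall>y\<in>X0. y \<noteq> x \<longrightarrow> \<mu> (gen \<Theta> X0 y) = \<nu> (gen \<Theta> X0 y)"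
        using \<mu> unfolding Hal_def by auto
      have \<nu>H: "\<nu> \<in> Hom \<Theta> (W \<Theta> X0) H" using A \<nu>(1) by blast
      have "\<nu> (gen \<Theta> X0 x) \<in> carrier H" using \<nu>H x by (auto intro: Hom_closed gen_carrier)
      \<comment> \<open>\<nu>' combines the value of the witness \<nu> at x with the values of
        \<mu>' elsewhere. It agrees with \<nu> on the free variables of p, so the induction
        hypothesis applies.\<close>
      then obtain \<nu>' where \<nu>': "\<nu>' \<in> Hom \<Theta> (W \<Theta> X0) H"
        "\<And>z. z \<in> X0 \<Longrightarrow> \<nu>' (gen \<Theta> X0 z) = (if z = x then \<nu> (gen \<Theta> X0 x) else \<mu>' (gen \<Theta> X0 z))"
        using Hom_W_update[OF H \<mu>', of "\<nu> (gen \<Theta> X0 x)" x] by blast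
      have "\<nu> (gen \<Theta> X0 y) = \<nu>' (gen \<Theta> X0 y)" if "y \<in> free_vars p" for y
      proof -
        have "y \<in> X0" using that p fo_over_free_vars by blast
        then show ?thesis using \<nu>(2) \<nu>'(2) eq[of y] that by auto
      qed
      then have "\<nu>' \<in> ?A" using FEx.IH[OF p \<nu>H \<nu>'(1)] \<nu>(1) by blast
      moreover have "\<forall>y\<in>X0. y \<noteq> x \<longrightarrow> \<mu>' (gen \<Theta> X0 y) = \<nu>' (gen \<Theta> X0 y)" using \<nu>'(2) by simp
      ultimately show ?thesis using \<mu>' unfolding Hal_def by auto
    qed
    have "\<eta> \<in> hex (Hal \<Theta> H) X0 x ?A \<longleftrightarrow> \<eta>' \<in> hex (Hal \<Theta> H) X0 x ?A"
      using step[of \<eta> \<eta>'] step[of \<eta>' \<eta>] FEx.prems by auto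
    then show ?case by (simp add: val car[OF p] x)
  qed
qed

section \<open>Extension of proper filters to ultrafilters\<close>

lemma proper_filter_Union_chain:
  assumes "\<C> \<noteq> {}" and C: "\<And>F. F \<in> \<C> \<Longrightarrow> proper_filter A X F"
    and chain: "\<And>F G. F \<in> \<C> \<Longrightarrow> G \<in> \<C> \<Longrightarrow> F \<subseteq> G \<or> G \<subseteq> F"
  shows "proper_filter A X (\<Union>\<C>)"
proof -
  have "hand A X a b \<in> \<Union>\<C>" if ab: "a \<in> \<Union>\<C>" "b \<in> \<Union>\<C>" for a b
  proof -
    obtain F where F: "F \<in> \<C>" "a \<in> F" "b \<in> F" using ab chain by blast
    then show ?thesis using C[OF F(1)] unfolding proper_filter_def by blast
  qed
  moreover have "b \<in> \<Union>\<C>" if ab: "a \<in> \<Union>\<C>" "b \<in> car A X" "hle A X a b" for a b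
  proof -
    obtain F where F: "F \<in> \<C>" "a \<in> F" using ab by blast
    then show ?thesis using C[OF F(1)] ab unfolding proper_filter_def by blast
  qed
  moreover have "\<Union>\<C> \<subseteq> car A X" "htop A X \<in> \<Union>\<C>" "hbot A X \<notin> \<Union>\<C>"
    using assms(1) C unfolding proper_filter_def by blast+
  ultimately show ?thesis unfolding proper_filter_def by blast
qed

text \<open>Zorn's lemma on the proper filters containing F. A maximal one among these is maximal
  among all proper filters, since any filter above it also contains F.\<close>

lemma ultrafilter_exists:
  assumes F: "proper_filter A X F"
  obtains U where "ultrafilter A X U" "F \<subseteq> U"
proof -
  let ?S = "{G. proper_filter A X G \<and> F \<subseteq> G}"
  have "\<exists>U\<in>?S. \<forall>G\<in>?S. U \<subseteq> G \<longrightarrow> G = U"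
  proof (rule subset_Zorn_nonempty)
    show "?S \<noteq> {}" using F by blast
    fix \<C> assume ne: "\<C> \<noteq> {}" and "subset.chain ?S \<C>"
    then have c: "\<C> \<subseteq> ?S" "\<And>F G. F \<in> \<C> \<Longrightarrow> G \<in> \<C> \<Longrightarrow> F \<subseteq> G \<or> G \<subseteq> F"
      unfolding subset_chain_def by simp_all
    then have "proper_filter A X (\<Union>\<C>)"
      by (intro proper_filter_Union_chain[OF ne]) auto
    then show "\<Union>\<C> \<in> ?S" using c(1) ne by blast
  qed
  then obtain U where U: "U \<in> ?S" "\<forall>G\<in>?S. U \<subseteq> G \<longrightarrow> G = U" by (rule bexE)
  have "ultrafilter A X U"
    unfolding ultrafilter_def
  proof (intro conjI allI impI)
    show "proper_filter A X U" using U(1) by blast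
    fix G assume "proper_filter A X G \<and> U \<subseteq> G"
    then have "G \<in> ?S" "U \<subseteq> G" using U(1) by auto
    then show "G = U" using U(2) by simp
  qed
  then show thesis using U(1) that by simp
qed

section \<open>Truth of special formulas and realization of types\<close>

lemma special_car:
  "halmos_closed \<Theta> X0 (\<Phi> \<Theta> X0) \<Longrightarrow> special \<Theta> X0 X \<subseteq> car (\<Phi> \<Theta> X0) X0"
  unfolding special_def using fo_class_car by auto

lemma special_Val_cong:
  assumes "in_variety \<Theta> H" "u \<in> special \<Theta> X0 X"
    and "\<eta> \<in> Hom \<Theta> (W \<Theta> X0) H" "\<eta>' \<in> Hom \<Theta> (W \<Theta> X0) H"
    and "\<And>x. x \<in> X \<Longrightarrow> \<eta> (gen \<Theta> X0 x) = \<eta>' (gen \<Theta> X0 x)"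
  shows "\<eta> \<in> Val \<Theta> X0 H X0 u \<longleftrightarrow> \<eta>' \<in> Val \<Theta> X0 H X0 u"
proof -
  obtain p where p: "u = fo_class \<Theta> X0 p" "fo_over \<Theta> X0 p" "free_vars p \<subseteq> X"
    using assms(2) unfolding special_def by blast
  show ?thesis
    unfolding p(1) by (rule Val_fo_class_cong[OF assms(1) p(2) assms(3,4)]) (use p(3) assms(5) in blast)
qed

text \<open>\<open>Val\<close> turns the finite meet formed in \<Phi> into an intersection in
  \<open>Hal\<close>, so one point satisfies all members of the list.\<close>

lemma X_type_point:
  assumes H: "in_variety \<Theta> H" and T: "X_type \<Theta> X0 H X T" and us: "set us \<subseteq> T"
  obtains \<eta> where "\<eta> \<in> Hom \<Theta> (W \<Theta> X0) H" "\<And>u. u \<in> set us \<Longrightarrow> \<eta> \<in> Val \<Theta> X0 H X0 u"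
proof -
  obtain \<eta> where \<eta>: "\<eta> \<in> Hom \<Theta> (W \<Theta> X0) H" "\<eta> \<in> Val \<Theta> X0 H X0 (hands (\<Phi> \<Theta> X0) X0 us)"
    using T us unfolding X_type_def by blast
  have X0: "X0 \<in> sorts X0" by (simp add: sorts_def)
  have "set us \<subseteq> car (\<Phi> \<Theta> X0) X0"
    using T us special_car[OF \<Phi>_closed[OF H]] unfolding X_type_def by blast
  then have "\<eta> \<in> hands (Hal \<Theta> H) X0 (map (Val \<Theta> X0 H X0) us)"
    using \<eta>(2) hom_hands[OF \<Phi>_closed[OF H] Val_hom[OF H] X0] by simp
  then show thesis using that \<eta>(1) by (auto simp: hands_Hal)
qed

text \<open>
  The sort \<open>{}\<close> is separate because \<open>W({})\<close> may be empty, and then there is no homomorphism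
  \<open>W(X0) \<rightarrow> W({})\<close>; but the truth of a sentence does not depend on the point.
\<close>

lemma X_type_empty_realized:
  fixes X0 :: "'v set"
  assumes H: "in_variety \<Theta> H" and T: "X_type \<Theta> X0 H {} T"
  obtains \<mu> where "\<mu> \<in> Hom \<Theta> (W \<Theta> {}) H" "T \<subseteq> Tp \<Theta> X0 H {} \<mu>"
proof -
  \<comment> \<open>With no generators to place, freeness yields a homomorphism even into an empty
    H; \<open>undefined\<close> is never taken as a value.\<close>
  obtain \<mu> where \<mu>: "\<mu> \<in> Hom \<Theta> (W \<Theta> ({} :: 'v set)) H" by (rule W_free[OF H, of "{} :: 'v set" "\<lambda>_. undefined"]) auto
  have "T \<subseteq> Tp \<Theta> X0 H {} \<mu>"
  proof
    fix u assume u: "u \<in> T"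
    then have sp: "u \<in> special \<Theta> X0 {}" using T unfolding X_type_def by blast
    obtain \<eta>0 where \<eta>0: "\<eta>0 \<in> Hom \<Theta> (W \<Theta> X0) H" "\<eta>0 \<in> Val \<Theta> X0 H X0 u"
      using X_type_point[OF H T, of "[u]"] u by auto
    then have "\<eta> \<in> Val \<Theta> X0 H X0 u" if "\<eta> \<in> Hom \<Theta> (W \<Theta> X0) H" for \<eta>
      using special_Val_cong[OF H sp that \<eta>0(1)] by blast
    then show "u \<in> Tp \<Theta> X0 H {} \<mu>" using sp unfolding Tp_def by blast
  qed
  then show thesis using that \<mu> by blast
qed

lemma X_type_nonempty_realized:
  assumes \<Theta>: "is_variety \<Theta>" and H: "in_variety \<Theta> H" and LG: "LG_saturated \<Theta> X0 H"
    and X: "X \<subseteq> X0" "finite X" "X \<noteq> {}" and T: "X_type \<Theta> X0 H X T"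
  obtains \<mu> where "\<mu> \<in> Hom \<Theta> (W \<Theta> X) H" "T \<subseteq> Tp \<Theta> X0 H X \<mu>"
proof -
  let ?P = "\<Phi> \<Theta> X0" and ?Val = "Val \<Theta> X0 H"
  have X0s: "X0 \<in> sorts X0" and Xs: "X \<in> sorts X0" using X by (auto simp: sorts_def)
  note cl = halmos_closedD[OF \<Phi>_closed[OF H]] and val = halmos_homD[OF Val_hom[OF H]]
  have Tsp: "T \<subseteq> special \<Theta> X0 X" using T unfolding X_type_def by blast
  then have Tcar: "T \<subseteq> car ?P X0" using special_car[OF \<Phi>_closed[OF H]] by blast
  \<comment> \<open>The generator of \<open>x0\<close> is the default image under s for the
    variables outside X.\<close>
  obtain x0 where x0: "x0 \<in> X" using X(3) by blast
  obtain s where s: "s \<in> Hom \<Theta> (W \<Theta> X0) (W \<Theta> X)"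
    and s_gen: "\<And>x. x \<in> X0 \<Longrightarrow> s (gen \<Theta> X0 x) = (if x \<in> X then gen \<Theta> X x else gen \<Theta> X x0)"
    by (rule W_free[OF in_variety_W[OF \<Theta>],
        of X0 "\<lambda>x. if x \<in> X then gen \<Theta> X x else gen \<Theta> X x0" X])
      (use x0 in \<open>auto simp: gen_carrier\<close>)
  \<comment> \<open>Pulling back along s is a definite way of extending a point from X to
    X0.\<close>
  let ?pull = "\<lambda>\<mu>. compose (carrier (W \<Theta> X0)) \<mu> s"
  have pull: "?pull \<mu> \<in> Hom \<Theta> (W \<Theta> X0) H" if "\<mu> \<in> Hom \<Theta> (W \<Theta> X) H" for \<mu>
    using Hom_W_compose[OF that s] .
  have pull_gen: "?pull \<mu> (gen \<Theta> X0 x) = \<mu> (gen \<Theta> X x)" if "x \<in> X" for \<mu> x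
    using that X(1) s_gen[of x] by (simp add: compose_gen subset_iff)
  have val_car: "?Val X a \<subseteq> Hom \<Theta> (W \<Theta> X) H" if "a \<in> car ?P X" for a
    using val(3)[OF Xs that] by (simp add: Hal_def)
  \<comment> \<open>The value of the meet of the formulas \<open>hsub ?P X0 X s u\<close> for u in
    the list, written directly as a set of points.\<close>
  define holds where "holds us = {\<mu> \<in> Hom \<Theta> (W \<Theta> X) H. \<forall>u\<in>set us. ?pull \<mu> \<in> ?Val X0 u}" for us
  \<comment> \<open>Membership is stated through values and not through the order of \<Phi>(X); thus
    the empty list already puts the theory of H into F.\<close>
  define F where "F = {a \<in> car ?P X. \<exists>us. set us \<subseteq> T \<and> holds us \<subseteq> ?Val X a}"
  have holds_ne: "holds us \<noteq> {}" if us: "set us \<subseteq> T" for us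
  proof -
    obtain \<eta> where \<eta>: "\<eta> \<in> Hom \<Theta> (W \<Theta> X0) H" "\<And>u. u \<in> set us \<Longrightarrow> \<eta> \<in> ?Val X0 u"
      using X_type_point[OF H T us] by blast
    have "\<eta> (gen \<Theta> X0 x) \<in> carrier H" if "x \<in> X" for x
      using that X(1) \<eta>(1) by (auto intro: Hom_closed gen_carrier)
    \<comment> \<open>\<mu> restricts \<eta> to X. Its pullback may differ from \<eta> outside X,
      which X-special formulas cannot detect. Nonemptiness of \<open>holds us\<close> is what will
      make F proper.\<close>
    then obtain \<mu> where \<mu>: "\<mu> \<in> Hom \<Theta> (W \<Theta> X) H" "\<And>x. x \<in> X \<Longrightarrow> \<mu> (gen \<Theta> X x) = \<eta> (gen \<Theta> X0 x)"
      using W_free[OF H, of X "\<lambda>x. \<eta> (gen \<Theta> X0 x)"] by blast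
    have "?pull \<mu> \<in> ?Val X0 u" if "u \<in> set us" for u
    proof -
      have sp: "u \<in> special \<Theta> X0 X" using that us Tsp by blast
      show ?thesis
        by (rule special_Val_cong[OF H sp pull[OF \<mu>(1)] \<eta>(1), THEN iffD2])
          (simp_all add: pull_gen \<mu>(2) \<eta>(2)[OF that])
    qed
    then show ?thesis using \<mu>(1) unfolding holds_def by blast
  qed
  have "proper_filter ?P X F"
    unfolding proper_filter_def
  proof (intro conjI ballI impI)
    show "F \<subseteq> car ?P X" unfolding F_def by blast
    have "holds [] \<subseteq> ?Val X (htop ?P X)" by (simp add: val(2)[OF Xs]) (simp add: Hal_def holds_def)
    then show "htop ?P X \<in> F"
      unfolding F_def using cl(2)[OF Xs] by (intro CollectI conjI exI[of _ "[]"]) auto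
    have "?Val X (hbot ?P X) = {}" by (simp add: val(1)[OF Xs]) (simp add: Hal_def)
    then show "hbot ?P X \<notin> F" unfolding F_def using holds_ne by blast
  next
    fix a b assume "a \<in> F" "b \<in> F"
    then obtain us vs where ab: "a \<in> car ?P X" "b \<in> car ?P X"
      and us: "set us \<subseteq> T" "holds us \<subseteq> ?Val X a" and vs: "set vs \<subseteq> T" "holds vs \<subseteq> ?Val X b"
      unfolding F_def by blast
    have "holds (us @ vs) \<subseteq> ?Val X a \<inter> ?Val X b" using us(2) vs(2) unfolding holds_def by auto
    then have "holds (us @ vs) \<subseteq> ?Val X (hand ?P X a b)"
      by (simp add: val(5)[OF Xs ab]) (simp add: Hal_def)
    then show "hand ?P X a b \<in> F"
      unfolding F_def using cl(4)[OF Xs ab] us(1) vs(1)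
      by (intro CollectI conjI exI[of _ "us @ vs"]) auto
  next
    fix a b assume a: "a \<in> F" and b: "b \<in> car ?P X" and le: "hle ?P X a b"
    have "a \<in> car ?P X" using a unfolding F_def by blast
    \<comment> \<open>\<open>hle\<close> is an equation, and \<open>Val\<close> turns it into an
      inclusion of sets of points.\<close>
    then have "?Val X a = ?Val X a \<inter> ?Val X b"
      using val(5)[OF Xs _ b, of a] le by (simp add: Hal_def)
    then show "b \<in> F" using a b unfolding F_def by blast
  qed
  then obtain U where U: "ultrafilter ?P X U" "F \<subseteq> U" by (rule ultrafilter_exists)
  have "Th \<Theta> X0 H X \<subseteq> F"
    unfolding Th_def F_def holds_def by (auto intro!: exI[of _ "[]"])
  then obtain \<mu> where \<mu>: "\<mu> \<in> Hom \<Theta> (W \<Theta> X) H" "U = LKer \<Theta> X0 H X \<mu>"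
    using LG U X unfolding LG_saturated_def by (meson subset_trans)
  have "T \<subseteq> Tp \<Theta> X0 H X \<mu>"
  proof
    fix u assume u: "u \<in> T"
    then have ucar: "u \<in> car ?P X0" and sp: "u \<in> special \<Theta> X0 X" using Tcar Tsp by auto
    have su: "?Val X (hsub ?P X0 X s u) = {\<mu> \<in> Hom \<Theta> (W \<Theta> X) H. ?pull \<mu> \<in> ?Val X0 u}"
      by (simp add: val(9)[OF X0s Xs s ucar]) (simp add: Hal_def)
    \<comment> \<open>The list \<open>[u]\<close> is the witness: \<open>holds [u]\<close> is
      exactly the value of this element.\<close>
    have "hsub ?P X0 X s u \<in> F"
      unfolding F_def using cl(8)[OF X0s Xs s ucar] u su
      by (intro CollectI conjI exI[of _ "[u]"]) (auto simp: holds_def)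
    then have "hsub ?P X0 X s u \<in> LKer \<Theta> X0 H X \<mu>" using U(2) \<mu>(2) by blast
    then have pu: "?pull \<mu> \<in> ?Val X0 u" using su by (auto simp: LKer_def)
    \<comment> \<open>\<open>Tp\<close> asks for truth at every extension of \<mu>. The pullback is
      one extension, and all of them agree with it on X.\<close>
    have "\<eta> \<in> ?Val X0 u"
      if "\<eta> \<in> Hom \<Theta> (W \<Theta> X0) H" "\<forall>x\<in>X. \<eta> (gen \<Theta> X0 x) = \<mu> (gen \<Theta> X x)" for \<eta>
      by (rule special_Val_cong[OF H sp that(1) pull[OF \<mu>(1)], THEN iffD2])
        (simp_all add: pull_gen that(2) pu)
    then show "u \<in> Tp \<Theta> X0 H X \<mu>" using sp unfolding Tp_def by blast
  qed
  then show thesis using that \<mu>(1) by blast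
qed

theorem theorem4p5:
  fixes \<Theta> :: "'f variety" and X0 :: "'v set" and H :: "('f, 'h) algebra"
  assumes "is_variety \<Theta>"
    and "infinite X0"
    and "in_variety \<Theta> H"
    and "LG_saturated \<Theta> X0 H"
  shows "MT_saturated \<Theta> X0 H"
  unfolding MT_saturated_def
proof (intro allI impI)
  fix X T assume "X \<subseteq> X0 \<and> finite X \<and> X_type \<Theta> X0 H X T"
  then have X: "X \<subseteq> X0" "finite X" and T: "X_type \<Theta> X0 H X T" by simp_all
  show "\<exists>\<mu>\<in>Hom \<Theta> (W \<Theta> X) H. T \<subseteq> Tp \<Theta> X0 H X \<mu>"
  proof (cases "X = {}")
    case True
    obtain \<mu> where "\<mu> \<in> Hom \<Theta> (W \<Theta> {}) H" "T \<subseteq> Tp \<Theta> X0 H {} \<mu>"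
      using X_type_empty_realized[OF assms(3) T[unfolded True]] .
    then show ?thesis unfolding True by blast
  next
    case False
    obtain \<mu> where "\<mu> \<in> Hom \<Theta> (W \<Theta> X) H" "T \<subseteq> Tp \<Theta> X0 H X \<mu>"
      using X_type_nonempty_realized[OF assms(1,3,4) X False T] .
    then show ?thesis by blast
  qed
qed

end
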